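(* Let $F(\alpha,\beta)$, $F(\gamma,\delta)$, $F(\epsilon,\zeta)$ be free groups of rank $2$ and let $S$ (Stallings' group) be the kernel of the homomorphism $F(\alpha,\beta)\times F(\gamma,\delta)\times F(\epsilon,\zeta)\to \mathbb{Z}=\langle t\rangle$ sending each of the six generators $\alpha,\beta,\gamma,\delta,\epsilon,\zeta$ to $t$. Then $S$ has $n^{7/3}$ as an isoperimetric function; that is, for every finite presentation of $S$ there is a constant $K>0$ such that the Dehn function of that presentation satisfies $\mathrm{Area}(n)\le K\,n^{7/3}$ for all $n\in\mathbb{N}$.
   Context: $S$ is finitely presented; it is presented by $$\langle\, a,b,c,d,s \mid [a,c],\,[a,d],\,[b,c],\,[b,d],\ s^a=s^b=s^c=s^d\,\rangle,$$ where $[x,y]=x^{-1}y^{-1}xy$, $s^x=x^{-1}sx$, and $s^a=s^b=s^c=s^d$ is shorthand for the six relators $x^{-1}sx\,y^{-1}s^{-1}y$ with $(x,y)\in\{(a,b),(a,c),(a,d),(b,c),(b,d),(c,d)\}$. The identification with the kernel is $a=\epsilon\alpha^{-1}$, $b=\epsilon\beta^{-1}$, $c=\epsilon\gamma^{-1}$, $d=\epsilon\delta^{-1}$, $s=\zeta\epsilon^{-1}$. Let $\langle\mathcal{A}\mid\mathcal{R}\rangle$ be a finite presentation of a group $\Gamma$. Words are words on $\mathcal{A}^{\pm1}$ and $\ell(w)$ is the length of $w$ (with no free reduction performed). If $w,w'$ represent the same element, one can convert $w$ to $w'$ via a finite sequence of words $w=w_0,w_1,\dots,w_m=w'$ in which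 each $w_{i+1}$ is obtained from $w_i$ by a free reduction (deleting a subword $xx^{-1}$, $x\in\mathcal{A}^{\pm1}$), by a free expansion (the inverse of this), or by applying a relator: $w_i=\sigma u\rho\mapsto \sigma v\rho=w_{i+1}$ where some cyclic conjugate of $uv^{-1}$ is in $\mathcal{R}^{\pm1}$. The cost of the sequence is the number of applications of relators in it. If $w=1$ in $\Gamma$, $\mathrm{Area}(w)$ is the minimal cost of a sequence converting $w$ to the empty word. The Dehn function is $\mathrm{Area}(n)=\max\{\mathrm{Area}(w): w=1\text{ in }\Gamma,\ \ell(w)\le n\}$. *)

theory Defs
  imports Complex_Main "HOL-Algebra.Elementary_Groups"
begin

section \<open>Words and free groups\<close>

text \<open>The letter \<open>(x, True)\<close> stands for the generator \<open>x\<close>, and \<open>(x, False)\<close> for its formal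
  inverse.  A word need not be reduced.\<close>

type_synonym 'a letter = "'a \<times> bool"
type_synonym 'a word = "'a letter list"

definition inv_letter :: "'a letter \<Rightarrow> 'a letter" where
  "inv_letter x = (fst x, \<not> snd x)"

definition inv_word :: "'a word \<Rightarrow> 'a word" where
  "inv_word w = rev (map inv_letter w)"

definition words :: "'a set \<Rightarrow> 'a word set" where
  "words A = lists (A \<times> UNIV)"

definition free_reduction :: "('a word \<times> 'a word) set" where
  "free_reduction = {(\<sigma> @ [x, inv_letter x] @ \<rho>, \<sigma> @ \<rho>) | \<sigma> x \<rho>. True}"

definition free_move :: "'a set \<Rightarrow> ('a word \<times> 'a word) set" where
  "free_move A = Restr (free_reduction \<union> free_reduction\<inverse>) (words A)"

definition free_equiv :: "'a set \<Rightarrow> ('a word \<times> 'a word) set" where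
  "free_equiv A = Restr ((free_move A)\<^sup>*) (words A)"

definition free_class :: "'a set \<Rightarrow> 'a word \<Rightarrow> 'a word set" where
  "free_class A w = free_equiv A `` {w}"

definition free_group :: "'a set \<Rightarrow> 'a word set monoid" where
  "free_group A =
     \<lparr>carrier = words A // free_equiv A,
      monoid.mult = (\<lambda>X Y. \<Union>u\<in>X. \<Union>v\<in>Y. free_class A (u @ v)),
      one = free_class A []\<rparr>"

definition free_gen :: "'a set \<Rightarrow> 'a \<Rightarrow> 'a word set" where
  "free_gen A x = free_class A [(x, True)]"


section \<open>Finite presentations\<close>

definition normal_closure :: "('g, 'm) monoid_scheme \<Rightarrow> 'g set \<Rightarrow> 'g set" where
  "normal_closure G X = \<Inter>{N. normal N G \<and> X \<subseteq> N}"

definition relator_closure :: "'a set \<Rightarrow> 'a word set \<Rightarrow> 'a word set set" where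
  "relator_closure A R = normal_closure (free_group A) (free_class A ` R)"

definition presented_group :: "'a set \<Rightarrow> 'a word set \<Rightarrow> 'a word set set monoid" where
  "presented_group A R = free_group A Mod relator_closure A R"

definition word_value :: "'a set \<Rightarrow> 'a word set \<Rightarrow> 'a word \<Rightarrow> 'a word set set" where
  "word_value A R w = relator_closure A R #>\<^bsub>free_group A\<^esub> free_class A w"

definition finite_presentation ::
    "'a set \<Rightarrow> 'a word set \<Rightarrow> ('g, 'm) monoid_scheme \<Rightarrow> bool" where
  "finite_presentation A R G \<longleftrightarrow>
     finite A \<and> finite R \<and> R \<subseteq> words A \<and> presented_group A R \<cong> G"


section \<open>Area and Dehn function\<close>

definition apply_relator :: "'a word set \<Rightarrow> ('a word \<times> 'a word) set" where
  "apply_relator R =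
     {(\<sigma> @ u @ \<rho>, \<sigma> @ v @ \<rho>) | \<sigma> u v \<rho>.
        \<exists>k. rotate k (u @ inv_word v) \<in> R \<union> inv_word ` R}"

text \<open>\<open>converts A R w m w'\<close>: some sequence of words on the letters of \<open>A\<close> and their inverses
  converts \<open>w\<close> to \<open>w'\<close> at cost \<open>m\<close>.\<close>

inductive converts :: "'a set \<Rightarrow> 'a word set \<Rightarrow> 'a word \<Rightarrow> nat \<Rightarrow> 'a word \<Rightarrow> bool"
  for A :: "'a set" and R :: "'a word set" where
  converts_refl: "w \<in> words A \<Longrightarrow> converts A R w 0 w"
| converts_free:
    "converts A R w m w' \<Longrightarrow> (w', w'') \<in> free_move A \<Longrightarrow> converts A R w m w''"
| converts_relator:
    "converts A R w m w' \<Longrightarrow> (w', w'') \<in> apply_relator R \<Longrightarrow> w'' \<in> words A \<Longrightarrow>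
     converts A R w (Suc m) w''"

definition null_words :: "'a set \<Rightarrow> 'a word set \<Rightarrow> 'a word set" where
  "null_words A R = {w \<in> words A. word_value A R w = \<one>\<^bsub>presented_group A R\<^esub>}"

text \<open>The minimum is over a nonempty set when \<open>w\<close> is a null word: see \<open>null_word_converts\<close>
  below.\<close>

definition area :: "'a set \<Rightarrow> 'a word set \<Rightarrow> 'a word \<Rightarrow> nat" where
  "area A R w = (LEAST m. converts A R w m [])"

text \<open>For finite \<open>A\<close> the maximum is over a finite nonempty set: see \<open>finite_short_null_words\<close>
  and \<open>Nil_null_word\<close> below.\<close>

definition dehn_function :: "'a set \<Rightarrow> 'a word set \<Rightarrow> nat \<Rightarrow> nat" where
  "dehn_function A R n = Max (area A R ` {w \<in> null_words A R. length w \<le> n})"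


section \<open>The product of three free groups\<close>

datatype generator = Alpha | Beta | Gamma | Delta | Epsilon | Zeta

abbreviation F\<^sub>1 :: "generator word set monoid" where "F\<^sub>1 \<equiv> free_group {Alpha, Beta}"
abbreviation F\<^sub>2 :: "generator word set monoid" where "F\<^sub>2 \<equiv> free_group {Gamma, Delta}"
abbreviation F\<^sub>3 :: "generator word set monoid" where "F\<^sub>3 \<equiv> free_group {Epsilon, Zeta}"

definition free_product3 ::
    "(generator word set \<times> generator word set \<times> generator word set) monoid" where
  "free_product3 = F\<^sub>1 \<times>\<times> F\<^sub>2 \<times>\<times> F\<^sub>3"

fun product_gen ::
    "generator \<Rightarrow> generator word set \<times> generator word set \<times> generator word set" where
  "product_gen Alpha = (free_gen {Alpha, Beta} Alpha, \<one>\<^bsub>F\<^sub>2\<^esub>, \<one>\<^bsub>F\<^sub>3\<^esub>)"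
| "product_gen Beta = (free_gen {Alpha, Beta} Beta, \<one>\<^bsub>F\<^sub>2\<^esub>, \<one>\<^bsub>F\<^sub>3\<^esub>)"
| "product_gen Gamma = (\<one>\<^bsub>F\<^sub>1\<^esub>, free_gen {Gamma, Delta} Gamma, \<one>\<^bsub>F\<^sub>3\<^esub>)"
| "product_gen Delta = (\<one>\<^bsub>F\<^sub>1\<^esub>, free_gen {Gamma, Delta} Delta, \<one>\<^bsub>F\<^sub>3\<^esub>)"
| "product_gen Epsilon = (\<one>\<^bsub>F\<^sub>1\<^esub>, \<one>\<^bsub>F\<^sub>2\<^esub>, free_gen {Epsilon, Zeta} Epsilon)"
| "product_gen Zeta = (\<one>\<^bsub>F\<^sub>1\<^esub>, \<one>\<^bsub>F\<^sub>2\<^esub>, free_gen {Epsilon, Zeta} Zeta)"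


section \<open>Basic facts\<close>

lemma words_simps [simp]:
  "[] \<in> words A" "x # w \<in> words A \<longleftrightarrow> fst x \<in> A \<and> w \<in> words A"
  "u @ v \<in> words A \<longleftrightarrow> u \<in> words A \<and> v \<in> words A"
  by (auto simp: words_def mem_Times_iff)

lemma fst_inv_letter [simp]: "fst (inv_letter x) = fst x"
  and inv_letter_inv_letter [simp]: "inv_letter (inv_letter x) = x"
  by (simp_all add: inv_letter_def)

lemma inv_word_simps [simp]:
  "inv_word [] = []" "inv_word (x # w) = inv_word w @ [inv_letter x]"
  "inv_word (u @ v) = inv_word v @ inv_word u" "inv_word (inv_word w) = w"
  by (simp_all add: inv_word_def rev_map comp_def)

lemma length_inv_word [simp]: "length (inv_word w) = length w"
  by (simp add: inv_word_def)

lemma inv_word_in_words [simp]: "inv_word w \<in> words A \<longleftrightarrow> w \<in> words A"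
  by (induction w) auto

lemma free_move_sym: "(u, v) \<in> free_move A \<Longrightarrow> (v, u) \<in> free_move A"
  by (auto simp: free_move_def)

lemma free_moveI:
  assumes "\<sigma> \<in> words A" "\<rho> \<in> words A" "fst x \<in> A"
  shows "(\<sigma> @ [x, inv_letter x] @ \<rho>, \<sigma> @ \<rho>) \<in> free_move A"
proof -
  have "(\<sigma> @ [x, inv_letter x] @ \<rho>, \<sigma> @ \<rho>) \<in> free_reduction"
    unfolding free_reduction_def by blast
  then show ?thesis
    using assms by (simp add: free_move_def)
qed

lemma free_reduction_ctx:
  "(u, v) \<in> free_reduction \<Longrightarrow> (p @ u @ q, p @ v @ q) \<in> free_reduction"
  unfolding free_reduction_def mem_Collect_eq
  by (elim exE conjE, rule_tac x = "p @ \<sigma>" in exI, rule_tac x = x in exI,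
      rule_tac x = "\<rho> @ q" in exI) simp

lemma free_move_ctx:
  assumes "(u, v) \<in> free_move A" "p \<in> words A" "q \<in> words A"
  shows "(p @ u @ q, p @ v @ q) \<in> free_move A"
  using assms free_reduction_ctx by (fastforce simp: free_move_def)

lemma free_equiv_refl: "w \<in> words A \<Longrightarrow> (w, w) \<in> free_equiv A"
  by (auto simp: free_equiv_def)

lemma free_equiv_sym: "(u, v) \<in> free_equiv A \<Longrightarrow> (v, u) \<in> free_equiv A"
  using sym_rtrancl[of "free_move A"] free_move_sym
  by (auto simp: free_equiv_def sym_def)

lemma free_equiv_trans:
  "(u, v) \<in> free_equiv A \<Longrightarrow> (v, w) \<in> free_equiv A \<Longrightarrow> (u, w) \<in> free_equiv A"
  by (auto simp: free_equiv_def)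

lemma free_equiv_words:
  "(u, v) \<in> free_equiv A \<Longrightarrow> u \<in> words A" "(u, v) \<in> free_equiv A \<Longrightarrow> v \<in> words A"
  by (auto simp: free_equiv_def)

lemma equiv_free_equiv: "equiv (words A) (free_equiv A)"
  by (intro equivI refl_onI symI transI)
     (auto intro: free_equiv_refl free_equiv_sym free_equiv_trans dest: free_equiv_words)

lemma free_move_equiv: "(u, v) \<in> free_move A \<Longrightarrow> (u, v) \<in> free_equiv A"
  by (auto simp: free_equiv_def free_move_def)

lemma free_equiv_ctx:
  assumes "(u, v) \<in> free_equiv A" "p \<in> words A" "q \<in> words A"
  shows "(p @ u @ q, p @ v @ q) \<in> free_equiv A"
proof -
  have "(u, v) \<in> (free_move A)\<^sup>*" "u \<in> words A" "v \<in> words A"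
    using assms by (auto simp: free_equiv_def)
  from this(1) have "(p @ u @ q, p @ v @ q) \<in> (free_move A)\<^sup>*"
    by induction (use assms in \<open>auto intro: free_move_ctx rtrancl_into_rtrancl\<close>)
  then show ?thesis
    using assms \<open>u \<in> words A\<close> \<open>v \<in> words A\<close> by (auto simp: free_equiv_def)
qed

lemma free_equiv_append:
  assumes "(u, u') \<in> free_equiv A" "(v, v') \<in> free_equiv A"
  shows "(u @ v, u' @ v') \<in> free_equiv A"
proof -
  have "([] @ u @ v, [] @ u' @ v) \<in> free_equiv A"
    by (rule free_equiv_ctx) (use assms free_equiv_words in auto)
  moreover have "(u' @ v @ [], u' @ v' @ []) \<in> free_equiv A"
    by (rule free_equiv_ctx) (use assms free_equiv_words in auto)
  ultimately show ?thesis
    by (auto intro: free_equiv_trans)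
qed

lemma free_class_eq_iff:
  "u \<in> words A \<Longrightarrow> v \<in> words A \<Longrightarrow> free_class A u = free_class A v \<longleftrightarrow> (u, v) \<in> free_equiv A"
  unfolding free_class_def using eq_equiv_class_iff[OF equiv_free_equiv] by blast

lemma carrier_free_group: "carrier (free_group A) = free_class A ` words A"
  by (auto simp: free_group_def quotient_def free_class_def)

lemma free_class_closed [simp]: "w \<in> words A \<Longrightarrow> free_class A w \<in> carrier (free_group A)"
  by (auto simp: carrier_free_group)

lemma one_free_group [simp]: "\<one>\<^bsub>free_group A\<^esub> = free_class A []"
  by (simp add: free_group_def)

lemma mult_free_group [simp]:
  assumes "u \<in> words A" "v \<in> words A"
  shows "free_class A u \<otimes>\<^bsub>free_group A\<^esub> free_class A v = free_class A (u @ v)"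
proof -
  have "free_class A (u' @ v') = free_class A (u @ v)"
    if "u' \<in> free_class A u" "v' \<in> free_class A v" for u' v'
  proof -
    have "(u @ v, u' @ v') \<in> free_equiv A"
      using that by (auto simp: free_class_def intro: free_equiv_append)
    then show ?thesis
      using free_class_eq_iff[of "u @ v" A "u' @ v'"] free_equiv_words[of "u @ v" "u' @ v'" A]
      by simp
  qed
  moreover have "u \<in> free_class A u" "v \<in> free_class A v"
    using assms by (auto simp: free_class_def free_equiv_refl)
  ultimately have "(\<Union>u'\<in>free_class A u. \<Union>v'\<in>free_class A v. free_class A (u' @ v'))
      = free_class A (u @ v)"
    by blast
  then show ?thesis
    by (simp add: free_group_def)
qed

lemma free_equiv_inv: "w \<in> words A \<Longrightarrow> (inv_word w @ w, []) \<in> free_equiv A"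
proof (induction w)
  case (Cons x w)
  have "(inv_word w @ [inv_letter x, inv_letter (inv_letter x)] @ w, inv_word w @ w) \<in> free_move A"
    by (rule free_moveI) (use Cons.prems in auto)
  then have "(inv_word (x # w) @ x # w, inv_word w @ w) \<in> free_equiv A"
    by (auto intro: free_move_equiv)
  with Cons show ?case
    by (meson free_equiv_trans words_simps(2))
qed (auto intro: free_equiv_refl)

lemma group_free_group: "group (free_group A)"
proof (rule groupI)
  fix x assume "x \<in> carrier (free_group A)"
  then obtain w where w: "w \<in> words A" "x = free_class A w"
    by (auto simp: carrier_free_group)
  then show "\<exists>y\<in>carrier (free_group A). y \<otimes>\<^bsub>free_group A\<^esub> x = \<one>\<^bsub>free_group A\<^esub>"
    by (intro bexI[of _ "free_class A (inv_word w)"]) (auto simp: free_class_eq_iff free_equiv_inv)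
qed (auto simp: carrier_free_group)

lemma inv_free_group:
  assumes "w \<in> words A"
  shows "inv\<^bsub>free_group A\<^esub> (free_class A w) = free_class A (inv_word w)"
  by (rule group.inv_equality[OF group_free_group])
     (use assms in \<open>auto simp: free_class_eq_iff free_equiv_inv\<close>)

lemma normal_carrier: "group G \<Longrightarrow> normal (carrier G) G"
  by (auto simp: group.normal_inv_iff group.subgroup_self group.is_monoid monoid.m_closed)

lemma normal_normal_closure:
  assumes G: "group G" and X: "X \<subseteq> carrier G"
  shows "normal (normal_closure G X) G"
proof -
  interpret group G by (rule G)
  let ?NN = "{N. normal N G \<and> X \<subseteq> N}"
  have ne: "?NN \<noteq> {}" using normal_carrier[OF G] X by auto
  have "subgroup (\<Inter>?NN) G"
    by (rule subgroups_Inter) (use ne in \<open>auto simp: normal_inv_iff\<close>)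
  then show ?thesis
    unfolding normal_closure_def by (auto simp: normal_inv_iff)
qed

lemma normal_relator_closure:
  "R \<subseteq> words A \<Longrightarrow> normal (relator_closure A R) (free_group A)"
  unfolding relator_closure_def
  by (rule normal_normal_closure[OF group_free_group]) auto

lemma null_words_iff:
  assumes "R \<subseteq> words A"
  shows "w \<in> null_words A R \<longleftrightarrow> w \<in> words A \<and> free_class A w \<in> relator_closure A R"
proof -
  let ?N = "relator_closure A R"
  have N: "subgroup ?N (free_group A)"
    by (rule normal_imp_subgroup[OF normal_relator_closure[OF assms]])
  have "?N #>\<^bsub>free_group A\<^esub> free_class A w = ?N \<longleftrightarrow> free_class A w \<in> ?N"
    if "w \<in> words A"
    using group.coset_join1[OF group_free_group _ free_class_closed[OF that] N]
      group.coset_join2[OF group_free_group free_class_closed[OF that] N]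
      subgroup.subset[OF N] by blast
  then show ?thesis
    unfolding null_words_def word_value_def presented_group_def FactGroup_def
    by (simp only: mem_Collect_eq monoid.simps) blast
qed

lemma Nil_null_word: "R \<subseteq> words A \<Longrightarrow> [] \<in> null_words A R"
  using normal_imp_subgroup[OF normal_relator_closure, THEN subgroup.one_closed]
  by (auto simp: null_words_iff)

lemma finite_short_null_words:
  assumes "finite A"
  shows "finite {w \<in> null_words A R. length w \<le> n}"
proof (rule finite_subset)
  show "{w \<in> null_words A R. length w \<le> n} \<subseteq> {w. set w \<subseteq> A \<times> UNIV \<and> length w \<le> n}"
    by (auto simp: null_words_def words_def)
  show "finite {w::'a word. set w \<subseteq> A \<times> UNIV \<and> length w \<le> n}"
    by (rule finite_lists_length_le) (use assms in auto)
qed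

lemma converts_words:
  "converts A R w m w' \<Longrightarrow> w \<in> words A \<and> w' \<in> words A"
  by (induction rule: converts.induct) (auto simp: free_move_def)

lemma converts_trans:
  assumes "converts A R v n w" "converts A R u m v"
  shows "converts A R u (m + n) w"
  using assms by (induction rule: converts.induct) (auto intro: converts.intros)

lemma apply_relator_ctx:
  "(u, v) \<in> apply_relator R \<Longrightarrow> (p @ u @ q, p @ v @ q) \<in> apply_relator R"
  unfolding apply_relator_def mem_Collect_eq
  by (elim exE conjE, rule_tac x = "p @ \<sigma>" in exI, rule_tac x = ua in exI,
      rule_tac x = va in exI, rule_tac x = "\<rho> @ q" in exI) auto

lemma converts_ctx:
  assumes "converts A R u m v" "p \<in> words A" "q \<in> words A"
  shows "converts A R (p @ u @ q) m (p @ v @ q)"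
  using assms
proof (induction rule: converts.induct)
  case (converts_free w m w' w'')
  then show ?case by (meson converts.converts_free free_move_ctx)
next
  case (converts_relator w m w' w'')
  then have "(p @ w' @ q, p @ w'' @ q) \<in> apply_relator R" "p @ w'' @ q \<in> words A"
    by (auto intro: apply_relator_ctx)
  with converts_relator show ?case by (meson converts.converts_relator)
qed (auto intro: converts.intros)

lemma converts_free_equiv:
  assumes "(u, v) \<in> free_equiv A"
  shows "converts A R u 0 v"
proof -
  have "(u, v) \<in> (free_move A)\<^sup>*" "u \<in> words A"
    using assms by (auto simp: free_equiv_def)
  then show ?thesis
    by (induction rule: rtrancl_induct) (auto intro: converts.intros)
qed

lemma converts_relator_Nil:
  assumes "r \<in> R" "R \<subseteq> words A"
  shows "converts A R r 1 []"
proof -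
  have "(r, []) \<in> apply_relator R"
    unfolding apply_relator_def mem_Collect_eq
    by (rule exI[of _ "[]"], rule exI[of _ r], rule exI[of _ "[]"], rule exI[of _ "[]"])
       (use assms(1) in \<open>auto intro!: exI[of _ 0]\<close>)
  then show ?thesis
    using converts_relator[OF converts_refl[of r A R]] assms by auto
qed

lemma converts_inv_Nil:
  assumes "converts A R w m []"
  shows "\<exists>n. converts A R (inv_word w) n []"
proof -
  have sym: "\<exists>n. converts A R w' n w" if "converts A R w m w'" for w m w'
    using that
  proof (induction rule: converts.induct)
    case (converts_free w m w' w'')
    then have "converts A R w'' 0 w'"
      by (meson converts_free_equiv free_move_equiv free_move_sym)
    with converts_free show ?case by (meson converts_trans)
  next
    case (converts_relator w m w' w'')
    then obtain p u v q k where *: "w' = p @ u @ q" "w'' = p @ v @ q"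
      "rotate k (u @ inv_word v) \<in> R \<union> inv_word ` R"
      unfolding apply_relator_def by blast
    let ?j = "length u + length v - k mod (length u + length v)"
    have inv_rot: "inv_word (rotate k x) = rotate (length x - k mod length x) (inv_word x)"
      for k and x :: "'a word"
    proof (cases "x = [] \<or> k mod length x = 0")
      case True
      then show ?thesis
        using rotate_conv_mod[of k x] by (auto simp: inv_word_def)
    next
      case False
      then have "k mod length x < length x" by simp
      with False have "length x - (length x - k mod length x) mod length x = k mod length x"
        by simp
      then show ?thesis
        using rotate_conv_mod[of k x] by (simp add: inv_word_def rotate_rev rotate_map)
    qed
    have "rotate ?j (v @ inv_word u) = inv_word (rotate k (u @ inv_word v))"
      using inv_rot[of k "u @ inv_word v"] by simp
    then have "rotate ?j (v @ inv_word u) \<in> R \<union> inv_word ` R"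
      using *(3) by (metis UnE UnI1 UnI2 imageE imageI inv_word_simps(4))
    then have "(w'', w') \<in> apply_relator R"
      unfolding apply_relator_def * by blast
    then have "converts A R w'' (Suc 0) w'"
      by (meson converts.converts_relator converts_refl converts_words
          converts_relator.hyps)
    with converts_relator show ?case by (meson converts_trans)
  qed (auto intro: converts.intros)
  obtain n where n: "converts A R [] n w" using sym[OF assms] by blast
  have w: "w \<in> words A" using converts_words[OF assms] by simp
  have "converts A R (inv_word w @ [] @ []) n (inv_word w @ w @ [])"
    by (rule converts_ctx[OF n]) (use w in auto)
  moreover have "converts A R (inv_word w @ w) 0 []"
    by (rule converts_free_equiv[OF free_equiv_inv[OF w]])
  ultimately show ?thesis by (auto dest: converts_trans)
qed

text \<open>A word representing the identity of the presented group can be converted to the empty word,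
  so \<open>area\<close> is a genuine minimum.\<close>

lemma null_word_converts:
  assumes R: "R \<subseteq> words A" and w: "w \<in> null_words A R"
  shows "\<exists>m. converts A R w m []"
proof -
  let ?N = "{free_class A v | v. v \<in> words A \<and> (\<exists>m. converts A R v m [])}"
  interpret group "free_group A" by (rule group_free_group)
  have app: "\<exists>m. converts A R (u @ v) m []"
    if u: "converts A R u m []" and v: "converts A R v n []" for u v m n
  proof -
    have "converts A R ([] @ u @ v) m ([] @ [] @ v)"
      by (rule converts_ctx[OF u]) (use converts_words[OF v] in auto)
    then show ?thesis using v by (auto dest: converts_trans)
  qed
  have conj: "\<exists>m. converts A R (p @ v @ inv_word p) m []"
    if v: "converts A R v m []" and p: "p \<in> words A" for p v m
  proof -
    have "converts A R (p @ v @ inv_word p) m (p @ [] @ inv_word p)"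
      by (rule converts_ctx[OF v]) (use p in auto)
    moreover have "converts A R (p @ inv_word p) 0 []"
      using converts_free_equiv[OF free_equiv_inv[of "inv_word p" A]] p by simp
    ultimately show ?thesis by (auto dest: converts_trans)
  qed
  have "subgroup ?N (free_group A)"
  proof (rule subgroupI)
    show "?N \<noteq> {}" using converts_refl[of "[]" A R] words_simps(1)[of A] by blast
  next
    fix a assume "a \<in> ?N"
    then show "inv\<^bsub>free_group A\<^esub> a \<in> ?N"
      using converts_inv_Nil by (fastforce simp: inv_free_group)
  next
    fix a b assume "a \<in> ?N" "b \<in> ?N"
    then show "a \<otimes>\<^bsub>free_group A\<^esub> b \<in> ?N"
      using app by (clarsimp) (metis words_simps(3) mult_free_group)
  qed auto
  moreover have "x \<otimes>\<^bsub>free_group A\<^esub> h \<otimes>\<^bsub>free_group A\<^esub> inv\<^bsub>free_group A\<^esub> x \<in> ?N"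
    if xh: "x \<in> carrier (free_group A)" "h \<in> ?N" for x h
  proof -
    obtain p v m where *: "p \<in> words A" "x = free_class A p" "v \<in> words A" "h = free_class A v"
      "converts A R v m []"
      using xh unfolding carrier_free_group by blast
    then have "x \<otimes>\<^bsub>free_group A\<^esub> h \<otimes>\<^bsub>free_group A\<^esub> inv\<^bsub>free_group A\<^esub> x
        = free_class A (p @ v @ inv_word p)"
      by (simp add: inv_free_group)
    then show ?thesis using conj[OF *(5,1)] * by auto
  qed
  ultimately have "normal ?N (free_group A)"
    by (simp only: normal_inv_iff) blast
  moreover have "free_class A ` R \<subseteq> ?N"
    using R converts_relator_Nil by blast
  ultimately have "relator_closure A R \<subseteq> ?N"
    unfolding relator_closure_def normal_closure_def by blast
  then obtain v m where v: "v \<in> words A" "free_class A w = free_class A v" "converts A R v m []"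
    using w null_words_iff[OF R] by auto
  have "w \<in> words A" using w by (simp add: null_words_def)
  then have "converts A R w 0 v"
    using v by (intro converts_free_equiv) (simp add: free_class_eq_iff)
  then show ?thesis using v(3) converts_trans by blast
qed

text \<open>A homomorphism to the integers with the value 1 at all six generators exists; it is given by
  the exponent sum.\<close>

definition exponent_sum :: "'a word \<Rightarrow> int" where
  "exponent_sum w = (\<Sum>x\<leftarrow>w. if snd x then 1 else - 1)"

lemma exponent_sum_free_equiv: "(u, v) \<in> free_equiv A \<Longrightarrow> exponent_sum u = exponent_sum v"
proof -
  assume "(u, v) \<in> free_equiv A"
  then have "(u, v) \<in> (free_move A)\<^sup>*" by (simp add: free_equiv_def)
  then show ?thesis
    by induction (auto simp: free_move_def free_reduction_def exponent_sum_def inv_letter_def)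
qed

definition class_sum :: "'a word set \<Rightarrow> int" where
  "class_sum X = exponent_sum (SOME w. w \<in> X)"

lemma class_sum_free_class:
  assumes "w \<in> words A"
  shows "class_sum (free_class A w) = exponent_sum w"
proof -
  have "w \<in> free_class A w" using assms by (simp add: free_class_def free_equiv_refl)
  then have "(SOME v. v \<in> free_class A w) \<in> free_class A w" by (metis someI)
  then show ?thesis
    unfolding class_sum_def free_class_def using exponent_sum_free_equiv by fastforce
qed

lemma product_hom_exists:
  "\<exists>\<phi> \<in> hom free_product3 integer_group. \<forall>g. \<phi> (product_gen g) = 1"
proof
  let ?\<phi> = "\<lambda>(x, y, z). class_sum x + class_sum y + class_sum z :: int"
  show "?\<phi> \<in> hom free_product3 integer_group"
    by (auto simp: hom_def free_product3_def DirProd_def carrier_free_group class_sum_free_class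
        exponent_sum_def)
  show "\<forall>g. ?\<phi> (product_gen g) = 1"
  proof
    fix g show "?\<phi> (product_gen g) = 1"
      by (cases g) (auto simp: free_gen_def class_sum_free_class exponent_sum_def)
  qed
qed

end

theory Submission
  imports Defs "HOL-Library.Product_Plus"
begin

text \<open>
  Groups are written additively.  Let \<open>w\<close> be a word in \<open>a, b, c, d, s\<close> of length at most \<open>n\<close>, let \<open>\<tau>\<close> be
  \<open>w\<close> with every \<open>s\<close> deleted, \<open>h\<close> the exponent sum of \<open>\<tau>\<close>, and \<open>\<rho>\<close> the word obtained from \<open>w\<close> by replacing
  each of \<open>a, b, c, d\<close> by \<open>c\<close>.  In Stallings' group \<open>w = X + \<tau>\<close>, where the spine \<open>X = \<rho> - h c\<close> is a product of
  conjugates of \<open>s\<close> by powers of \<open>c\<close>.  If \<open>w\<close> represents the identity, then \<open>X\<close> is freely trivial and \<open>\<tau>\<close>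
  has quadratic area, so it suffices to convert \<open>w\<close> to \<open>X + \<tau>\<close>.

  For a word of length \<open>k\<close> this costs \<open>O(k\<^sup>3)\<close>: moving one \<open>s\<close> to its place costs \<open>O(k\<^sup>2)\<close>.  A word \<open>p\<close>
  without \<open>s\<close>, of length at most \<open>n\<close> and exponent sum \<open>H\<close>, can be rewritten at cost \<open>O(n\<^sup>2)\<close> as
  \<open>H c + U + V\<close>, where \<open>U\<close> commutes with \<open>c\<close> and \<open>s\<close>, and \<open>V\<close> with \<open>a\<close> and \<open>s\<close>, each at cost \<open>O(n)\<close>.  As the
  spine of a block of length \<open>k\<close> is a word of length \<open>O(k)\<close> in \<open>c\<close> and \<open>s\<close>, and can be changed at cost
  \<open>O(k\<^sup>3)\<close> into one in \<open>a\<close> and \<open>s\<close>, it moves past \<open>p\<close> at cost \<open>O(n\<^sup>2 + n k + k\<^sup>3)\<close>.  With \<open>n / k\<close> blocks of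
  length \<open>k = n\<^bsup>2/3\<^esup>\<close> the total cost is \<open>O(n\<^bsup>7/3\<^esup>)\<close>.
\<close>

section \<open>Area in a group\<close>

text \<open>The base case admits every \<open>m\<close>, so the index bounds the number of
  conjugates from above. Over a free group this is the algebraic form of area, in which free
  reductions cost nothing.\<close>

inductive null_area :: "'g::group_add set \<Rightarrow> nat \<Rightarrow> 'g \<Rightarrow> bool" for R :: "'g set" where
  null_area_zero: "null_area R m 0"
| null_area_step: "null_area R m x \<Longrightarrow> r \<in> R \<or> - r \<in> R \<Longrightarrow> null_area R (Suc m) (g + r - g + x)"

lemma null_area_mono: "null_area R m x \<Longrightarrow> m \<le> n \<Longrightarrow> null_area R n x"
proof (induction arbitrary: n rule: null_area.induct)
  case (null_area_step m x r g)
  then show ?case by (cases n) (auto intro: null_area.null_area_step)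
qed (rule null_area_zero)

lemma null_area_add:
  "null_area R m x \<Longrightarrow> null_area R n y \<Longrightarrow> null_area R (m + n) (x + y)"
proof (induction rule: null_area.induct)
  case (null_area_step m x r g)
  then have "null_area R (Suc (m + n)) (g + r - g + (x + y))"
    by (auto intro: null_area.null_area_step)
  then show ?case by (simp add: add.assoc)
qed (auto intro: null_area_mono)

lemma null_area_conj: "null_area R m x \<Longrightarrow> null_area R m (g + x - g)"
proof (induction rule: null_area.induct)
  case (null_area_step m x r h)
  then have "null_area R (Suc m) ((g + h) + r - (g + h) + (g + x - g))"
    by (auto intro: null_area.null_area_step)
  then show ?case by (simp add: add.assoc diff_conv_add_uminus minus_add del: add_uminus_conv_diff)
qed (auto intro: null_area_zero)

lemma null_area_uminus: "null_area R m x \<Longrightarrow> null_area R m (- x)"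
proof (induction rule: null_area.induct)
  case (null_area_step m x r g)
  have "null_area R (Suc 0) (g + (- r) - g + 0)"
    by (rule null_area.null_area_step[OF null_area_zero]) (use null_area_step in auto)
  from null_area_add[OF null_area_step.IH this]
  have "null_area R (Suc m) (- x + (g + (- r) - g))" by simp
  then show ?case by (simp add: add.assoc diff_conv_add_uminus minus_add del: add_uminus_conv_diff)
qed (auto intro: null_area_zero)

section \<open>Equality and commutation up to a cost\<close>

definition cost_eq :: "'g::group_add set \<Rightarrow> nat \<Rightarrow> 'g \<Rightarrow> 'g \<Rightarrow> bool" where
  "cost_eq R m x y \<longleftrightarrow> null_area R m (x - y)"

definition cost_comm :: "'g::group_add set \<Rightarrow> nat \<Rightarrow> 'g \<Rightarrow> 'g \<Rightarrow> bool" where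
  "cost_comm R m x y \<longleftrightarrow> cost_eq R m (x + y) (y + x)"

lemma cost_eq_refl [simp]: "cost_eq R m x x"
  by (simp add: cost_eq_def null_area_zero)

lemma cost_eq_sym: "cost_eq R m x y \<Longrightarrow> cost_eq R m y x"
  using null_area_uminus[of R m "x - y"] by (simp add: cost_eq_def)

lemma cost_eq_mono: "cost_eq R m x y \<Longrightarrow> m \<le> n \<Longrightarrow> cost_eq R n x y"
  by (auto simp: cost_eq_def intro: null_area_mono)

lemma cost_eq_trans: "cost_eq R m x y \<Longrightarrow> cost_eq R n y z \<Longrightarrow> cost_eq R (m + n) x z"
  using null_area_add[of R m "x - y" n "y - z"]
  by (simp add: cost_eq_def add.assoc diff_conv_add_uminus del: add_uminus_conv_diff)

lemma cost_eq_left: "cost_eq R m x y \<Longrightarrow> cost_eq R m (g + x) (g + y)"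
  using null_area_conj[of R m "x - y" g]
  by (simp add: cost_eq_def add.assoc diff_conv_add_uminus minus_add del: add_uminus_conv_diff)

lemma cost_eq_right: "cost_eq R m x y \<Longrightarrow> cost_eq R m (x + g) (y + g)"
  by (simp add: cost_eq_def add.assoc diff_conv_add_uminus minus_add del: add_uminus_conv_diff)

lemma cost_eq_ctx: "cost_eq R m x y \<Longrightarrow> cost_eq R m (p + x + q) (p + y + q)"
  by (intro cost_eq_left cost_eq_right)

lemma cost_comm_sym: "cost_comm R m x y \<Longrightarrow> cost_comm R m y x"
  by (simp add: cost_comm_def cost_eq_sym)

lemma cost_comm_mono: "cost_comm R m x y \<Longrightarrow> m \<le> n \<Longrightarrow> cost_comm R n x y"
  by (auto simp: cost_comm_def intro: cost_eq_mono)

lemma cost_comm_zero [simp]: "cost_comm R m 0 y" "cost_comm R m x 0"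
  by (simp_all add: cost_comm_def)

lemma cost_comm_self [simp]: "cost_comm R m x x"
  by (simp add: cost_comm_def)

lemma cost_comm_add_left:
  assumes "cost_comm R m x z" "cost_comm R n y z"
  shows "cost_comm R (m + n) (x + y) z"
proof -
  have "cost_eq R n (x + (y + z)) (x + (z + y))"
    using assms(2) by (simp add: cost_comm_def cost_eq_left)
  moreover have "cost_eq R m (x + z + y) (z + x + y)"
    using assms(1) by (simp add: cost_comm_def cost_eq_right)
  ultimately show ?thesis
    using cost_eq_trans[of R n "x + (y + z)" "x + (z + y)" m "z + x + y"]
    by (simp add: cost_comm_def add.assoc add.commute)
qed

lemma cost_comm_uminus_left:
  assumes "cost_comm R m x z"
  shows "cost_comm R m (- x) z"
proof -
  have "cost_eq R m (- x + (z + x) + - x) (- x + (x + z) + - x)"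
    using assms by (intro cost_eq_ctx) (simp add: cost_comm_def cost_eq_sym)
  then show ?thesis
    by (simp add: cost_comm_def add.assoc diff_conv_add_uminus del: add_uminus_conv_diff)
qed

lemma cost_comm_diff_left:
  "cost_comm R m x z \<Longrightarrow> cost_comm R n y z \<Longrightarrow> cost_comm R (m + n) (x - y) z"
  using cost_comm_add_left[OF _ cost_comm_uminus_left, of R m x z n y] by simp

lemma cost_comm_add_right:
  "cost_comm R m x y \<Longrightarrow> cost_comm R n x z \<Longrightarrow> cost_comm R (m + n) x (y + z)"
  by (meson cost_comm_add_left cost_comm_sym)

lemma cost_comm_uminus_right: "cost_comm R m x z \<Longrightarrow> cost_comm R m x (- z)"
  by (meson cost_comm_uminus_left cost_comm_sym)

lemma cost_comm_diff_right:
  "cost_comm R m x y \<Longrightarrow> cost_comm R n x z \<Longrightarrow> cost_comm R (m + n) x (y - z)"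
  by (meson cost_comm_diff_left cost_comm_sym)

text \<open>The replacement of \<open>y\<close> by \<open>x\<close> is made before the commutation
  and undone after it, hence \<open>n\<close> on both sides of \<open>m\<close>.\<close>

lemma cost_comm_cong:
  assumes "cost_comm R m x z" "cost_eq R n x y"
  shows "cost_comm R (n + m + n) y z"
  using assms unfolding cost_comm_def
  by (meson cost_eq_left cost_eq_right cost_eq_sym cost_eq_trans)


section \<open>Integer multiples\<close>

definition zmul :: "int \<Rightarrow> 'g::group_add \<Rightarrow> 'g" where
  "zmul i x = (if 0 \<le> i then ((+) x ^^ nat i) 0 else ((+) (- x) ^^ nat (- i)) 0)"

lemma zmul_0 [simp]: "zmul 0 x = 0"
  and zmul_1 [simp]: "zmul 1 x = x"
  and zmul_m1 [simp]: "zmul (- 1) x = - x"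
  by (simp_all add: zmul_def)

lemma zmul_succ: "zmul (1 + i) x = x + zmul i x"
proof (cases "0 \<le> i")
  case True
  then have "nat (1 + i) = Suc (nat i)" by simp
  with True show ?thesis by (simp add: zmul_def)
next
  case False
  then have "nat (- i) = Suc (nat (- (1 + i)))" by simp
  then have "zmul i x = - x + ((+) (- x) ^^ nat (- (1 + i))) 0"
    using False by (simp add: zmul_def)
  also have "((+) (- x) ^^ nat (- (1 + i))) 0 = zmul (1 + i) x"
    using False by (cases "i = - 1") (auto simp: zmul_def)
  finally show ?thesis by simp
qed

lemma zmul_pred: "zmul (i - 1) x = - x + zmul i x"
  using zmul_succ[of "i - 1" x] by (simp add: add.commute)

lemma zmul_add: "zmul (i + j) x = zmul i x + zmul j x"
proof (induction i rule: int_induct[where k = 0])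
  case (step1 i)
  have "zmul (i + 1 + j) x = zmul (1 + (i + j)) x" by (simp add: add.commute add.left_commute)
  then show ?case using step1 zmul_succ[of i x] zmul_succ[of "i + j" x]
    by (simp add: add.assoc add.commute[of i 1])
next
  case (step2 i)
  have "zmul (i - 1 + j) x = zmul ((i + j) - 1) x" by (simp add: algebra_simps)
  then show ?case using step2 by (simp only: zmul_pred) (simp add: add.assoc)
qed simp

lemma zmul_uminus: "zmul (- i) x = - zmul i x"
  using zmul_add[of "- i" i x] by (simp add: eq_neg_iff_add_eq_0)

lemma cost_comm_zmul_right:
  assumes "cost_comm R m x y"
  shows "cost_comm R (nat \<bar>i\<bar> * m) x (zmul i y)"
proof (induction i rule: int_induct[where k = 0])
  case (step1 i)
  from cost_comm_add_right[OF assms this(2)] step1(1) show ?case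
    by (simp add: nat_add_distrib zmul_succ add.commute[of i 1])
next
  case (step2 i)
  from cost_comm_add_right[OF cost_comm_uminus_right[OF assms] this(2)]
  have "cost_comm R (m + nat \<bar>i\<bar> * m) x (zmul (i - 1) y)"
    by (simp add: zmul_pred)
  moreover have "nat \<bar>i - 1\<bar> = Suc (nat \<bar>i\<bar>)" using step2(1) by simp
  ultimately show ?case by (simp del: abs_of_nonpos)
qed simp


section \<open>Evaluation of words\<close>

definition letter_value :: "('a \<Rightarrow> 'g::group_add) \<Rightarrow> 'a letter \<Rightarrow> 'g" where
  "letter_value f x = (if snd x then f (fst x) else - f (fst x))"

definition eval_word :: "('a \<Rightarrow> 'g::group_add) \<Rightarrow> 'a word \<Rightarrow> 'g" where
  "eval_word f w = sum_list (map (letter_value f) w)"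

lemma eval_word_simps [simp]:
  "eval_word f [] = 0" "eval_word f (x # w) = letter_value f x + eval_word f w"
  "eval_word f (u @ v) = eval_word f u + eval_word f v"
  by (simp_all add: eval_word_def)

lemma letter_value_inv_letter [simp]: "letter_value f (inv_letter x) = - letter_value f x"
  by (simp add: letter_value_def inv_letter_def)

lemma eval_word_inv_word [simp]: "eval_word f (inv_word w) = - eval_word f w"
  by (induction w) (simp_all add: minus_add)

lemma eval_word_cong:
  "w \<in> words A \<Longrightarrow> (\<And>x. x \<in> A \<Longrightarrow> f x = g x) \<Longrightarrow> eval_word f w = eval_word g w"
  by (induction w) (auto simp: letter_value_def)

lemma eval_word_free_equiv:
  assumes "(u, v) \<in> free_equiv A"
  shows "eval_word f u = eval_word f v"
proof -
  have "(u, v) \<in> (free_move A)\<^sup>*" using assms by (simp add: free_equiv_def)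
  then show ?thesis
    by induction (auto simp: free_move_def free_reduction_def simp flip: add.assoc)
qed

lemma exponent_sum_simps [simp]:
  "exponent_sum [] = 0"
  "exponent_sum (x # w) = (if snd x then 1 else - 1) + exponent_sum w"
  "exponent_sum (u @ v) = exponent_sum u + exponent_sum v"
  by (simp_all add: exponent_sum_def)

lemma abs_exponent_sum_le: "\<bar>exponent_sum w\<bar> \<le> int (length w)"
  by (induction w) auto

lemma cost_comm_eval_word:
  assumes "\<And>x. x \<in> fst ` set w \<Longrightarrow> cost_comm R m y (f x)"
  shows "cost_comm R (length w * m) y (eval_word f w)"
  using assms
proof (induction w)
  case (Cons x w)
  have "cost_comm R m y (letter_value f x)"
    using Cons.prems by (auto simp: letter_value_def intro: cost_comm_uminus_right)
  from cost_comm_add_right[OF this Cons.IH] Cons.prems show ?case by simp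
qed simp

definition power_word :: "'a \<Rightarrow> int \<Rightarrow> 'a word" where
  "power_word x i = replicate (nat \<bar>i\<bar>) (x, 0 \<le> i)"

lemma length_power_word [simp]: "length (power_word x i) = nat \<bar>i\<bar>"
  and set_power_word: "fst ` set (power_word x i) \<subseteq> {x}"
  by (auto simp: power_word_def)

lemma eval_word_replicate:
  "eval_word f (replicate n (x, e)) = zmul (if e then int n else - int n) (f x)"
proof (induction n)
  case (Suc n)
  have "- 1 - int n = - int n - 1" by simp
  then have "zmul (- 1 - int n) (f x) = - f x + zmul (- int n) (f x)"
    by (simp only: zmul_pred)
  with Suc show ?case by (simp add: letter_value_def zmul_succ split: if_splits)
qed simp

lemma eval_power_word [simp]: "eval_word f (power_word x i) = zmul i (f x)"
  by (simp add: power_word_def eval_word_replicate)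

lemma exponent_sum_power_word [simp]: "exponent_sum (power_word x i) = i"
proof -
  have "exponent_sum (replicate n (x, e)) = (if e then int n else - int n)" for n e
    by (induction n) auto
  then show ?thesis by (simp add: power_word_def)
qed

section \<open>The isoperimetric inequality\<close>

datatype stallings_gen = GA | GB | GC | GD | GS

definition strip_s :: "stallings_gen word \<Rightarrow> stallings_gen word" where
  "strip_s w = filter (\<lambda>x. fst x \<noteq> GS) w"

definition ab_part :: "stallings_gen word \<Rightarrow> stallings_gen word" where
  "ab_part w = filter (\<lambda>x. fst x \<in> {GA, GB}) w"

definition cd_part :: "stallings_gen word \<Rightarrow> stallings_gen word" where
  "cd_part w = filter (\<lambda>x. fst x \<in> {GC, GD}) w"

definition height :: "stallings_gen word \<Rightarrow> int" where
  "height w = exponent_sum (strip_s w)"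

definition collapse :: "stallings_gen \<Rightarrow> stallings_gen \<Rightarrow> stallings_gen" where
  "collapse y x = (if x = GS then GS else y)"

lemma strip_s_simps [simp]:
  "strip_s [] = []" "strip_s (u @ v) = strip_s u @ strip_s v" "length (strip_s w) \<le> length w"
  "strip_s (x # w) = (if fst x = GS then strip_s w else x # strip_s w)"
  by (simp_all add: strip_s_def)

lemma height_simps [simp]:
  "height [] = 0" "height (u @ v) = height u + height v"
  by (simp_all add: height_def)

lemma abs_height_le: "nat \<bar>height w\<bar> \<le> length w"
  using abs_exponent_sum_le[of "strip_s w"] strip_s_simps(3)[of w] unfolding height_def by linarith

lemma exponent_sum_ab_cd:
  "GS \<notin> fst ` set w \<Longrightarrow> exponent_sum (ab_part w) + exponent_sum (cd_part w) = exponent_sum w"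
proof (induction w)
  case (Cons x w)
  then show ?case by (cases "fst x") (auto simp: ab_part_def cd_part_def)
qed (simp add: ab_part_def cd_part_def)

lemma parts_strip_s [simp]: "ab_part (strip_s w) = ab_part w" "cd_part (strip_s w) = cd_part w"
  by (induction w) (auto simp: ab_part_def cd_part_def)

text \<open>In multiplicative notation s^x = s^y says that x y^{-1} commutes with s, which is the
  second assumption. The four pairs allowed there link all four conjugates of s.\<close>

locale stallings_relations =
  fixes R :: "'g::group_add set" and g :: "stallings_gen \<Rightarrow> 'g"
  assumes comm_ab_cd: "x \<in> {GA, GB} \<Longrightarrow> y \<in> {GC, GD} \<Longrightarrow> cost_comm R 1 (g x) (g y)"
    and comm_s_diff: "x \<in> {GA, GB} \<Longrightarrow> y \<in> {GC, GD} \<Longrightarrow> cost_comm R 1 (g x - g y) (g GS)"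
begin

section \<open>Words without \<open>s\<close>\<close>

abbreviation ev :: "stallings_gen word \<Rightarrow> 'g" where "ev \<equiv> eval_word g"

text \<open>Each letter \<open>x\<close> of \<open>u\<close> is replaced by \<open>x - y\<close>, which commutes with \<open>y\<close> and with \<open>s\<close>.\<close>

lemma pull_out_power:
  assumes "\<And>x. x \<in> L \<Longrightarrow> cost_comm R 1 (g x) (g y)"
    and "\<And>x. x \<in> L \<Longrightarrow> cost_comm R 1 (g x - g y) (g GS)"
    and "fst ` set u \<subseteq> L"
  shows "\<exists>U. cost_eq R ((length u)\<^sup>2) (ev u) (U + zmul (exponent_sum u) (g y))
    \<and> cost_comm R (length u) U (g y) \<and> cost_comm R (length u) U (g GS)"
  using assms(3)
proof (induction u)
  case (Cons z u)
  let ?n = "length u" and ?p = "zmul (exponent_sum u) (g y)"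
  define x where "x = g (fst z)"
  have z: "fst z \<in> L" using Cons.prems by simp
  obtain U where U: "cost_eq R (?n\<^sup>2) (ev u) (U + ?p)"
    "cost_comm R ?n U (g y)" "cost_comm R ?n U (g GS)"
    using Cons by auto
  \<comment> \<open>One more letter costs at most 1 for itself and \<open>?n\<close> for moving one
    copy of \<open>g y\<close> past \<open>U\<close>; the difference of the two squares covers
    this.\<close>
  have n: "(Suc ?n)\<^sup>2 = 1 + ?n\<^sup>2 + ?n + ?n" by (simp add: power2_eq_square)
  have xy: "cost_comm R 1 (x - g y) (g y)"
    using cost_comm_diff_left[of R 1 x "g y" 0 "g y"] assms(1)[OF z] by (simp add: x_def)
  have xs: "cost_comm R 1 (x - g y) (g GS)"
    using assms(2)[OF z] by (simp add: x_def)
  show ?case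
  proof (cases "snd z")
    case True
    have "cost_eq R (?n\<^sup>2) (x + ev u) (x + (U + ?p))"
      using U(1) by (rule cost_eq_left)
    moreover have "cost_eq R ?n ((x - g y) + (g y + U) + ?p) ((x - g y) + (U + g y) + ?p)"
      using U(2) by (intro cost_eq_ctx) (simp add: cost_comm_def cost_eq_sym)
    ultimately have "cost_eq R (?n\<^sup>2 + ?n) (x + ev u) ((x - g y) + U + zmul (1 + exponent_sum u) (g y))"
      using cost_eq_trans[of R "?n\<^sup>2" "x + ev u" "x + (U + ?p)" ?n]
      by (simp add: zmul_succ add.assoc diff_conv_add_uminus del: add_uminus_conv_diff)
    then have "cost_eq R ((length (z # u))\<^sup>2) (ev (z # u))
        ((x - g y) + U + zmul (exponent_sum (z # u)) (g y))"
      using True n by (auto simp: letter_value_def x_def elim: cost_eq_mono)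
    then show ?thesis
      using cost_comm_add_left[OF xy U(2)] cost_comm_add_left[OF xs U(3)] by auto
  next
    case False
    \<comment> \<open>For a negative letter, \<open>- x\<close> is read as
      \<open>(- x + g y) - g y\<close>. One commutation turns the bracket into
      \<open>g y - x\<close>, the negative of \<open>x - g y\<close>.\<close>
    have yx: "cost_comm R 1 (g y - x) v" if "cost_comm R 1 (x - g y) v" for v
      using cost_comm_uminus_left[OF that] by simp
    have "cost_eq R 1 (- x + (g y + x) + - x) (- x + (x + g y) + - x)"
      using assms(1)[OF z] by (intro cost_eq_ctx) (simp add: cost_comm_def cost_eq_sym x_def)
    then have 1: "cost_eq R 1 (- x + g y) (g y - x)"
      by (simp add: add.assoc diff_conv_add_uminus del: add_uminus_conv_diff)
    from cost_eq_right[OF this, of "- g y + ev u"]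
    have 1: "cost_eq R 1 (- x + ev u) ((g y - x) + - g y + ev u)"
      by (simp add: add.assoc del: add_uminus_conv_diff)
    have 2: "cost_eq R (?n\<^sup>2) ((g y - x) + - g y + ev u) ((g y - x) + - g y + (U + ?p))"
      using U(1) by (rule cost_eq_left)
    have "cost_eq R ?n ((g y - x) + (- g y + U) + ?p) ((g y - x) + (U + - g y) + ?p)"
      using cost_comm_uminus_right[OF U(2)] by (intro cost_eq_ctx) (simp only: cost_comm_def cost_eq_sym)
    then have 3: "cost_eq R ?n ((g y - x) + - g y + (U + ?p)) ((g y - x) + U + zmul (exponent_sum u - 1) (g y))"
      by (simp add: zmul_pred add.assoc del: add_uminus_conv_diff)
    from cost_eq_trans[OF cost_eq_trans[OF 1 2] 3]
    have "cost_eq R ((length (z # u))\<^sup>2) (ev (z # u))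
        ((g y - x) + U + zmul (exponent_sum (z # u)) (g y))"
      using False n by (auto simp: letter_value_def x_def elim!: cost_eq_mono)
    then show ?thesis
      using cost_comm_add_left[OF yx[OF xy] U(2)] cost_comm_add_left[OF yx[OF xs] U(3)] by auto
  qed
qed (auto intro!: exI[of _ 0])

text \<open>A letter \<open>c\<close> or \<open>d\<close> in front of a sorted word moves past the
  letters of its \<open>ab_part\<close> at cost 1 each, so every letter contributes at most linear
  cost.\<close>

lemma split_ab_cd:
  "GS \<notin> fst ` set w \<Longrightarrow> cost_eq R ((length w)\<^sup>2) (ev w) (ev (ab_part w) + ev (cd_part w))"
proof (induction w)
  case (Cons z w)
  let ?n = "length w" and ?u = "ev (ab_part w)" and ?v = "ev (cd_part w)" and ?x = "letter_value g z"
  have IH: "cost_eq R (?n\<^sup>2) (?x + ev w) (?x + (?u + ?v))"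
    using Cons by (auto intro: cost_eq_left)
  have n: "?n\<^sup>2 + ?n \<le> (Suc ?n)\<^sup>2" by (simp add: power2_eq_square)
  show ?case
  proof (cases "fst z \<in> {GA, GB}")
    case True
    with IH have "cost_eq R (?n\<^sup>2) (ev (z # w)) (ev (ab_part (z # w)) + ev (cd_part (z # w)))"
      by (auto simp: ab_part_def cd_part_def add.assoc)
    then show ?thesis using n by (auto elim: cost_eq_mono)
  next
    case False
    with Cons.prems have z: "fst z \<in> {GC, GD}" by (cases "fst z") auto
    have "cost_comm R 1 ?x (g y)" if "y \<in> fst ` set (ab_part w)" for y
      using that comm_ab_cd[of y "fst z"] z
      by (auto simp: ab_part_def letter_value_def intro: cost_comm_sym cost_comm_uminus_left)
    then have "cost_comm R (length (ab_part w) * 1) ?x ?u"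
      by (rule cost_comm_eval_word)
    then have "cost_comm R ?n ?x ?u"
      by (rule cost_comm_mono) (simp add: ab_part_def)
    then have "cost_eq R ?n (?x + ?u + ?v) (?u + ?x + ?v)"
      unfolding cost_comm_def by (rule cost_eq_right)
    with IH have "cost_eq R (?n\<^sup>2 + ?n) (?x + ev w) (?u + ?x + ?v)"
      by (metis add.assoc cost_eq_trans)
    then show ?thesis using n z by (auto simp: ab_part_def cd_part_def add.assoc elim: cost_eq_mono)
  qed
qed (simp add: ab_part_def cd_part_def)

text \<open>\<open>U\<close> comes from the letters \<open>a\<close>, \<open>b\<close> after their
  power of \<open>c\<close> is pulled out, \<open>V\<close> from the letters \<open>c\<close>,
  \<open>d\<close> after a power of \<open>a\<close> is pulled out.\<close>

lemma decompose:
  assumes "GS \<notin> fst ` set w"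
  shows "\<exists>U V. cost_eq R (7 * (length w)\<^sup>2) (ev w) (zmul (exponent_sum w) (g GC) + U + V)
    \<and> cost_comm R (length w) U (g GC) \<and> cost_comm R (length w) U (g GS)
    \<and> cost_comm R (2 * length w) V (g GA) \<and> cost_comm R (2 * length w) V (g GS)"
proof -
  let ?n = "length w" and ?c = "\<lambda>i. zmul i (g GC)"
  define u v where "u = ab_part w" and "v = cd_part w"
  define j i where "j = exponent_sum u" and "i = exponent_sum v"
  have lu: "length u \<le> ?n" and lv: "length v \<le> ?n"
    by (simp_all add: u_def v_def ab_part_def cd_part_def)
  have ij: "exponent_sum w = j + i"
    using exponent_sum_ab_cd[OF assms] by (simp add: u_def v_def i_def j_def)
  have uL: "fst ` set u \<subseteq> {GA, GB}" and vL: "fst ` set v \<subseteq> {GC, GD}"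
    by (auto simp: u_def v_def ab_part_def cd_part_def)
  obtain U where U: "cost_eq R ((length u)\<^sup>2) (ev u) (U + ?c j)"
    "cost_comm R (length u) U (g GC)" "cost_comm R (length u) U (g GS)"
    using pull_out_power[of "{GA, GB}" GC u] comm_ab_cd comm_s_diff uL unfolding j_def by blast
  \<comment> \<open>The added power of \<open>c\<close> makes the exponent sum of \<open>v'\<close>
    zero, so no power of \<open>a\<close> remains next to \<open>V\<close>. It at most doubles the
    length, which explains the factors 4 and 2 below.\<close>
  define v' where "v' = power_word GC (- i) @ v"
  have "\<bar>i\<bar> \<le> int (length v)" unfolding i_def by (rule abs_exponent_sum_le)
  then have lv': "length v' \<le> 2 * ?n" using lv by (simp add: v'_def)
  have v'L: "fst ` set v' \<subseteq> {GC, GD}"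
    using vL set_power_word[of GC "- i"] by (auto simp: v'_def)
  have av: "cost_comm R 1 (g x) (g GA)" "cost_comm R 1 (g x - g GA) (g GS)" if "x \<in> {GC, GD}" for x
    using comm_ab_cd[of GA x] cost_comm_uminus_left[OF comm_s_diff[of GA x]] that
    by (auto intro: cost_comm_sym)
  obtain V where V: "cost_eq R ((length v')\<^sup>2) (ev v') V"
    "cost_comm R (length v') V (g GA)" "cost_comm R (length v') V (g GS)"
    using pull_out_power[OF av v'L] by (auto simp: v'_def i_def)
  have *: "(length v')\<^sup>2 \<le> 4 * ?n\<^sup>2" "(length u)\<^sup>2 \<le> ?n\<^sup>2"
    using power_mono[OF lv', of 2] power_mono[OF lu, of 2] by (simp_all add: power_mult_distrib)
  have "nat \<bar>exponent_sum w\<bar> \<le> ?n" using abs_exponent_sum_le[of w] by simp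
  then have n2: "nat \<bar>exponent_sum w\<bar> * length u \<le> ?n\<^sup>2"
    using lu by (simp add: power2_eq_square mult_mono)
  have 1: "cost_eq R (?n\<^sup>2) (ev w) (ev u + ev v)"
    unfolding u_def v_def by (rule split_ab_cd[OF assms])
  have 2: "cost_eq R (?n\<^sup>2) (ev u + ev v) (U + ?c j + ev v)"
    by (rule cost_eq_right[OF cost_eq_mono[OF U(1) *(2)]])
  have "cost_eq R (4 * ?n\<^sup>2) (U + ?c (j + i) + ev v') (U + ?c (j + i) + V)"
    by (rule cost_eq_left[OF cost_eq_mono[OF V(1) *(1)]])
  then have 3: "cost_eq R (4 * ?n\<^sup>2) (U + ?c j + ev v) (U + ?c (j + i) + V)"
    by (simp add: v'_def zmul_add zmul_uminus add.assoc)
  have "cost_comm R (?n\<^sup>2) U (?c (j + i))"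
    using cost_comm_zmul_right[OF U(2), of "j + i"] n2 ij by (auto elim: cost_comm_mono)
  then have 4: "cost_eq R (?n\<^sup>2) (U + ?c (j + i) + V) (?c (j + i) + U + V)"
    unfolding cost_comm_def by (rule cost_eq_right)
  \<comment> \<open>The terms pay for sorting, for rewriting \<open>u\<close>, for rewriting
    \<open>v'\<close>, and for moving the power of \<open>c\<close> past \<open>U\<close>.\<close>
  have "cost_eq R (?n\<^sup>2 + ?n\<^sup>2 + 4 * ?n\<^sup>2 + ?n\<^sup>2) (ev w) (?c (exponent_sum w) + U + V)"
    unfolding ij by (rule cost_eq_trans[OF cost_eq_trans[OF cost_eq_trans[OF 1 2] 3] 4])
  then have "cost_eq R (7 * ?n\<^sup>2) (ev w) (?c (exponent_sum w) + U + V)"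
    by (rule cost_eq_mono) simp
  then show ?thesis
    using U(2,3) V(2,3) lu lv' cost_comm_mono by blast
qed

text \<open>Without its power of \<open>c\<close> the word is \<open>U + V\<close>, and both
  summands commute with \<open>s\<close> at linear cost. Passing to \<open>U + V\<close> and back
  costs 7 each time and the commutation at most 3, all times the squared length.\<close>

lemma comm_s_level_zero:
  assumes "GS \<notin> fst ` set w"
  shows "cost_comm R (17 * (length w)\<^sup>2) (- zmul (exponent_sum w) (g GC) + ev w) (g GS)"
proof -
  let ?n = "length w" and ?h = "zmul (exponent_sum w) (g GC)"
  obtain U V where UV: "cost_eq R (7 * ?n\<^sup>2) (ev w) (?h + U + V)"
    "cost_comm R ?n U (g GS)" "cost_comm R (2 * ?n) V (g GS)"
    using decompose[OF assms] by blast
  have "cost_eq R (7 * ?n\<^sup>2) (- ?h + (?h + U + V)) (- ?h + ev w)"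
    by (rule cost_eq_left[OF cost_eq_sym[OF UV(1)]])
  then have "cost_eq R (7 * ?n\<^sup>2) (U + V) (- ?h + ev w)"
    by (simp add: add.assoc)
  moreover have "?n \<le> ?n\<^sup>2" by (simp only: power2_eq_square le_square)
  ultimately show ?thesis
    using cost_comm_mono[OF cost_comm_cong[OF cost_comm_add_left[OF UV(2,3)]]] by auto
qed

section \<open>Spines\<close>

text \<open>\<open>spine y w\<close> is the product of the conjugates of the letters \<open>s\<close> of \<open>w\<close> by powers of \<open>y\<close>, the
  exponent being the height at which the letter occurs.\<close>

definition spine :: "stallings_gen \<Rightarrow> stallings_gen word \<Rightarrow> 'g" where
  "spine y w = eval_word (g \<circ> collapse y) w - zmul (height w) (g y)"

text \<open>Appending \<open>v\<close> to \<open>u\<close> raises the heights in \<open>v\<close> by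
  \<open>height u\<close>, which conjugates its spine by that power of \<open>y\<close>.\<close>

lemma spine_append:
  "spine y (u @ v) = spine y u + (zmul (height u) (g y) + spine y v - zmul (height u) (g y))"
  by (simp add: spine_def zmul_add add.assoc diff_conv_add_uminus minus_add del: add_uminus_conv_diff)

lemma spine_Nil [simp]: "spine y [] = 0"
  by (simp add: spine_def)

text \<open>The spine is the value of a word in \<open>y\<close> and \<open>s\<close> of length at
  most \<open>2 * length w\<close>: the collapsed word followed by a power of
  \<open>y\<close>.\<close>

lemma cost_comm_spine:
  assumes "cost_comm R m x (g y)" "cost_comm R m x (g GS)"
  shows "cost_comm R (2 * length w * m) x (spine y w)"
proof -
  have "cost_comm R (length w * m) x (eval_word (g \<circ> collapse y) w)"
    by (rule cost_comm_eval_word) (use assms in \<open>auto simp: collapse_def\<close>)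
  moreover have "cost_comm R (length w * m) x (zmul (height w) (g y))"
    using cost_comm_zmul_right[OF assms(1), of "height w"] abs_height_le[of w]
    by (auto elim!: cost_comm_mono)
  ultimately have "cost_comm R (length w * m + length w * m) x (spine y w)"
    unfolding spine_def by (rule cost_comm_diff_right)
  then show ?thesis by (rule cost_comm_mono) simp
qed

text \<open>Letters are appended on the right. A new \<open>s\<close> must only pass
  \<open>- ?h + ev (strip_s w)\<close>, which has exponent sum 0 and commutes with \<open>s\<close>
  at quadratic cost. Any other letter leaves the spine unchanged and is free.\<close>

lemma ev_spine_cubic:
  "cost_eq R (17 * length w ^ 3) (ev w) (spine GC w + ev (strip_s w))"
proof (induction w rule: rev_induct)
  case (snoc z w)
  let ?n = "length w" and ?h = "zmul (height w) (g GC)" and ?x = "letter_value g z"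
  have IH: "cost_eq R (17 * ?n ^ 3) (ev w + ?x) (spine GC w + ev (strip_s w) + ?x)"
    using snoc by (rule cost_eq_right)
  have n: "17 * ?n ^ 3 + 17 * ?n\<^sup>2 \<le> 17 * (Suc ?n) ^ 3"
    by (simp add: power2_eq_square power3_eq_cube algebra_simps)
  show ?case
  proof (cases "fst z = GS")
    case True
    have "cost_comm R (17 * (length (strip_s w))\<^sup>2) (- ?h + ev (strip_s w)) (g GS)"
      unfolding height_def by (rule comm_s_level_zero) (auto simp: strip_s_def)
    then have "cost_comm R (17 * ?n\<^sup>2) (- ?h + ev (strip_s w)) ?x"
      using True by (auto simp: letter_value_def intro: cost_comm_uminus_right elim!: cost_comm_mono)
    then have "cost_eq R (17 * ?n\<^sup>2)
        (eval_word (g \<circ> collapse GC) w + ((- ?h + ev (strip_s w)) + ?x))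
        (eval_word (g \<circ> collapse GC) w + (?x + (- ?h + ev (strip_s w))))"
      unfolding cost_comm_def by (rule cost_eq_left)
    moreover have "height [z] = 0" "letter_value (g \<circ> collapse GC) z = ?x"
      using True by (simp_all add: height_def letter_value_def collapse_def)
    ultimately have "cost_eq R (17 * ?n\<^sup>2) (spine GC w + ev (strip_s w) + ?x)
        (spine GC (w @ [z]) + ev (strip_s (w @ [z])))"
      using True
      by (simp add: spine_def add.assoc diff_conv_add_uminus minus_add del: add_uminus_conv_diff)
    from cost_eq_mono[OF cost_eq_trans[OF IH this] n] show ?thesis by simp
  next
    case False
    have "spine GC [z] = 0"
      using False by (simp add: spine_def height_def letter_value_def collapse_def)
    then have "spine GC (w @ [z]) = spine GC w"
      by (simp add: spine_append)
    then have "cost_eq R (17 * ?n ^ 3) (ev (w @ [z])) (spine GC (w @ [z]) + ev (strip_s (w @ [z])))"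
      using IH False by (simp add: add.assoc)
    from cost_eq_mono[OF this add_leD1[OF n]] show ?thesis by simp
  qed
qed simp

text \<open>The cubic bound is applied to the word \<open>v\<close> obtained from \<open>w\<close>
  by turning each of \<open>a\<close>, \<open>b\<close>, \<open>c\<close>, \<open>d\<close> into
  \<open>a\<close>. It has the same spine in \<open>c\<close> as \<open>w\<close>, and deleting
  \<open>s\<close> leaves a power of \<open>a\<close>, which cancels against the one in
  \<open>spine GA w\<close>.\<close>

lemma spine_a_c_cubic: "cost_eq R (17 * length w ^ 3) (spine GA w) (spine GC w)"
proof -
  let ?f = "\<lambda>x. (collapse GA (fst x), snd x)"
  define v where "v = map ?f w"
  have ev: "ev v = eval_word (g \<circ> collapse GA) w"
    unfolding v_def by (induction w) (auto simp: letter_value_def)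
  have ev_c: "eval_word (g \<circ> collapse GC) v = eval_word (g \<circ> collapse GC) w"
    unfolding v_def by (induction w) (auto simp: letter_value_def collapse_def)
  have h: "height v = height w"
    unfolding v_def height_def by (induction w) (auto simp: collapse_def)
  have "ev (strip_s v) = zmul (height w) (g GA)"
    unfolding v_def height_def
    by (induction w) (auto simp: collapse_def letter_value_def zmul_succ zmul_pred)
  with ev_spine_cubic[of v] have "cost_eq R (17 * length w ^ 3)
      (eval_word (g \<circ> collapse GA) w) (spine GC w + zmul (height w) (g GA))"
    by (simp add: ev ev_c h spine_def) (simp add: v_def)
  from cost_eq_right[OF this, of "- zmul (height w) (g GA)"] show ?thesis
    by (simp add: spine_def add.assoc diff_conv_add_uminus del: add_uminus_conv_diff)
qed

section \<open>Spines past prefixes and the division into blocks\<close>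

lemma spine_past_prefix:
  assumes "GS \<notin> fst ` set p" and "length p \<le> n" and "length w \<le> k"
  shows "cost_eq R (14 * n\<^sup>2 + 6 * n * k + 34 * k ^ 3) (ev p + spine GC w)
    (zmul (exponent_sum p) (g GC) + spine GC w - zmul (exponent_sum p) (g GC) + ev p)"
proof -
  let ?h = "zmul (exponent_sum p) (g GC)" and ?X = "spine GC w" and ?Y = "spine GA w"
  obtain U V where "cost_eq R (7 * (length p)\<^sup>2) (ev p) (?h + U + V)"
    "cost_comm R (length p) U (g GC)" "cost_comm R (length p) U (g GS)"
    "cost_comm R (2 * length p) V (g GA)" "cost_comm R (2 * length p) V (g GS)"
    using decompose[OF assms(1)] by blast
  then have UV: "cost_eq R (7 * n\<^sup>2) (ev p) (?h + U + V)"
    "cost_comm R n U (g GC)" "cost_comm R n U (g GS)"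
    "cost_comm R (2 * n) V (g GA)" "cost_comm R (2 * n) V (g GS)"
    using assms(2) by (auto elim!: cost_eq_mono cost_comm_mono intro: power_mono)
  have "17 * length w ^ 3 \<le> 17 * k ^ 3"
    using assms(3) by (simp add: power_mono)
  then have YX: "cost_eq R (17 * k ^ 3) ?Y ?X"
    using spine_a_c_cubic[of w] by (rule cost_eq_mono[rotated])
  have "2 * length w * (2 * n) \<le> 4 * n * k" and "2 * length w * n \<le> 2 * n * k"
    using assms(3) by (simp_all add: mult.commute)
  then have cV: "cost_comm R (4 * n * k) V ?Y" and cU: "cost_comm R (2 * n * k) U ?X"
    using cost_comm_spine[OF UV(4,5), of w] cost_comm_spine[OF UV(2,3), of w]
    by (auto elim: cost_comm_mono)
  \<comment> \<open>\<open>V\<close> passes the spine in its form \<open>?Y\<close>, written in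
    \<open>a\<close> and \<open>s\<close>, and \<open>U\<close> passes it in its form
    \<open>?X\<close>, written in \<open>c\<close> and \<open>s\<close>. The change of form is paid
    for twice, and so is the decomposition of \<open>p\<close>, which is restored at the
    end.\<close>
  have 1: "cost_eq R (7 * n\<^sup>2) (ev p + ?X) (?h + U + V + ?X)"
    by (rule cost_eq_right[OF UV(1)])
  have 2: "cost_eq R (17 * k ^ 3) (?h + U + V + ?X) (?h + U + V + ?Y)"
    by (rule cost_eq_left[OF cost_eq_sym[OF YX]])
  have 3: "cost_eq R (4 * n * k) (?h + U + V + ?Y) (?h + U + ?Y + V)"
    using cost_eq_left[OF cV[unfolded cost_comm_def], of "?h + U"] by (simp add: add.assoc)
  have 4: "cost_eq R (17 * k ^ 3) (?h + U + ?Y + V) (?h + U + ?X + V)"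
    by (rule cost_eq_ctx[OF YX])
  have 5: "cost_eq R (2 * n * k) (?h + U + ?X + V) (?h + ?X + U + V)"
    using cost_eq_ctx[OF cU[unfolded cost_comm_def], of ?h V] by (simp add: add.assoc)
  have "cost_eq R (7 * n\<^sup>2) (?h + ?X - ?h + (?h + U + V)) (?h + ?X - ?h + ev p)"
    by (rule cost_eq_left[OF cost_eq_sym[OF UV(1)]])
  then have 6: "cost_eq R (7 * n\<^sup>2) (?h + ?X + U + V) (?h + ?X - ?h + ev p)"
    by (simp add: add.assoc diff_conv_add_uminus del: add_uminus_conv_diff)
  note trans = cost_eq_trans
  have "cost_eq R (7 * n\<^sup>2 + 17 * k ^ 3 + 4 * n * k + 17 * k ^ 3 + 2 * n * k + 7 * n\<^sup>2)
      (ev p + ?X) (?h + ?X - ?h + ev p)"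
    by (rule trans[OF trans[OF trans[OF trans[OF trans[OF 1 2] 3] 4] 5] 6])
  then show ?thesis by (rule cost_eq_mono) simp
qed

text \<open>The induction keeps \<open>p\<close> arbitrary because it collects the letters other
  than \<open>s\<close> of the blocks already treated. A block pays \<open>17 * k ^ 3\<close> for
  splitting off its spine and the rest for moving that spine past \<open>p\<close>; the conjugated
  spines fuse by \<open>spine_append\<close>.\<close>

lemma ev_spine_blocks:
  assumes "GS \<notin> fst ` set p" and "length p + length (concat ws) \<le> n"
    and "\<And>w. w \<in> set ws \<Longrightarrow> length w \<le> k"
  shows "cost_eq R (length ws * (14 * n\<^sup>2 + 6 * n * k + 51 * k ^ 3)) (ev p + ev (concat ws))
    (zmul (exponent_sum p) (g GC) + spine GC (concat ws) - zmul (exponent_sum p) (g GC)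
      + ev (p @ strip_s (concat ws)))"
  using assms
proof (induction ws arbitrary: p)
  case (Cons w ws)
  let ?c = "\<lambda>i. zmul i (g GC)" and ?h = "exponent_sum p" and ?r = "ev (concat ws)"
  let ?p = "p @ strip_s w"
  let ?M = "14 * n\<^sup>2 + 6 * n * k + 51 * k ^ 3"
  have w: "length w \<le> k" using Cons.prems by simp
  have "17 * length w ^ 3 \<le> 17 * k ^ 3"
    using w by (simp add: power_mono)
  then have "cost_eq R (17 * k ^ 3) (ev w) (spine GC w + ev (strip_s w))"
    using ev_spine_cubic[of w] by (rule cost_eq_mono[rotated])
  then have 1: "cost_eq R (17 * k ^ 3) (ev p + ev w + ?r) (ev p + (spine GC w + ev (strip_s w)) + ?r)"
    by (rule cost_eq_ctx)
  have "cost_eq R (14 * n\<^sup>2 + 6 * n * k + 34 * k ^ 3) (ev p + spine GC w)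
      (?c ?h + spine GC w - ?c ?h + ev p)"
    using Cons.prems w by (intro spine_past_prefix) auto
  from cost_eq_right[OF this, of "ev (strip_s w) + ?r"]
  have 2: "cost_eq R (14 * n\<^sup>2 + 6 * n * k + 34 * k ^ 3) (ev p + (spine GC w + ev (strip_s w)) + ?r)
      (?c ?h + spine GC w - ?c ?h + (ev ?p + ?r))"
    by (simp add: add.assoc)
  have "cost_eq R (length ws * ?M) (ev ?p + ?r)
      (?c (exponent_sum ?p) + spine GC (concat ws) - ?c (exponent_sum ?p) + ev (?p @ strip_s (concat ws)))"
    using Cons.prems length_filter_le[of "\<lambda>x. fst x \<noteq> GS" w]
    by (intro Cons.IH) (auto simp: strip_s_def simp del: strip_s_simps length_filter_le)
  then have 3: "cost_eq R (length ws * ?M) (?c ?h + spine GC w - ?c ?h + (ev ?p + ?r))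
      (?c ?h + spine GC w - ?c ?h
        + (?c (exponent_sum ?p) + spine GC (concat ws) - ?c (exponent_sum ?p) + ev (?p @ strip_s (concat ws))))"
    by (rule cost_eq_left)
  have "?c (exponent_sum ?p) = ?c ?h + ?c (height w)"
    by (simp add: zmul_add height_def)
  then have 4: "?c ?h + spine GC w - ?c ?h
        + (?c (exponent_sum ?p) + spine GC (concat ws) - ?c (exponent_sum ?p) + ev (?p @ strip_s (concat ws)))
      = ?c ?h + spine GC (concat (w # ws)) - ?c ?h + ev (p @ strip_s (concat (w # ws)))"
    by (simp add: spine_append add.assoc diff_conv_add_uminus minus_add del: add_uminus_conv_diff)
  have "cost_eq R (17 * k ^ 3 + (14 * n\<^sup>2 + 6 * n * k + 34 * k ^ 3) + length ws * ?M)
      (ev p + ev w + ?r) (?c ?h + spine GC (concat (w # ws)) - ?c ?h + ev (p @ strip_s (concat (w # ws))))"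
    using cost_eq_trans[OF cost_eq_trans[OF 1 2] 3] unfolding 4 .
  then show ?case by (simp add: add.assoc) (erule cost_eq_mono, simp)
qed simp

text \<open>There are at most \<open>m\<close> blocks of length at most \<open>m\<^sup>2\<close>.
  With \<open>n = m ^ 3\<close> and \<open>k = m\<^sup>2\<close>, the terms \<open>n\<^sup>2\<close>
  and \<open>k ^ 3\<close> are both \<open>m ^ 6\<close>, so this block length balances them. Cubes
  as length bounds keep all exponents integral.\<close>

lemma null_area_7_3:
  assumes "length w \<le> m ^ 3" and "spine GC w = 0"
    and "ev (ab_part w) = 0" "ev (cd_part w) = 0"
  shows "null_area R (72 * m ^ 7) (ev w)"
proof -
  have "\<exists>ws. length ws \<le> N \<and> concat ws = v \<and> (\<forall>w\<in>set ws. length w \<le> k)"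
    if "length v \<le> N * k" for N k and v :: "stallings_gen word"
    using that
  proof (induction N arbitrary: v)
    case (Suc N)
    have "length (drop k v) \<le> N * k" using Suc.prems by simp
    then obtain ws where ws: "length ws \<le> N" "concat ws = drop k v" "\<forall>w\<in>set ws. length w \<le> k"
      using Suc.IH by blast
    show ?case by (rule exI[of _ "take k v # ws"]) (use ws in auto)
  qed auto
  from this[of w m "m\<^sup>2"] obtain ws where
    ws: "length ws \<le> m" "concat ws = w" "\<And>w. w \<in> set ws \<Longrightarrow> length w \<le> m\<^sup>2"
    using assms(1) by (auto simp: power2_eq_square power3_eq_cube)
  let ?M = "14 * (m ^ 3)\<^sup>2 + 6 * m ^ 3 * m\<^sup>2 + 51 * (m\<^sup>2) ^ 3"
  have blocks: "cost_eq R (length ws * ?M) (ev w) (ev (strip_s w))"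
    using ev_spine_blocks[of "[]" ws "m ^ 3" "m\<^sup>2"] ws assms(1,2) by simp
  have "m ^ 5 \<le> m ^ 6" by (cases "m = 0") (auto intro: power_increasing)
  then have "?M \<le> 71 * m ^ 6"
    by (simp flip: power_mult power_add)
  from mult_mono[OF ws(1) this] have "length ws * ?M \<le> m * (71 * m ^ 6)"
    by simp
  also have "m * (71 * m ^ 6) = 71 * m ^ 7"
    using power_Suc[of m 6] by simp
  finally have "length ws * ?M \<le> 71 * m ^ 7" .
  with blocks have 1: "cost_eq R (71 * m ^ 7) (ev w) (ev (strip_s w))"
    by (rule cost_eq_mono)
  \<comment> \<open>What remains has no \<open>s\<close>, and its two parts have value 0, so sorting
    it finishes the conversion.\<close>
  have "GS \<notin> fst ` set (strip_s w)" by (auto simp: strip_s_def)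
  then have 2: "cost_eq R ((length (strip_s w))\<^sup>2) (ev (strip_s w)) 0"
    using split_ab_cd[of "strip_s w"] assms(3,4) by simp
  have "(length (strip_s w))\<^sup>2 \<le> (m ^ 3)\<^sup>2"
    using assms(1) strip_s_simps(3)[of w] by (intro power_mono) linarith+
  also have "\<dots> \<le> m ^ 7"
    by (cases "m = 0") (auto simp flip: power_mult intro: power_increasing)
  finally have "cost_eq R (71 * m ^ 7 + m ^ 7) (ev w) 0"
    by (rule cost_eq_trans[OF 1 cost_eq_mono[OF 2]])
  then show ?thesis by (simp add: cost_eq_def)
qed

end

section \<open>Free groups as a type of class group-add\<close>

lemma words_UNIV [simp]: "words UNIV = UNIV"
  by (auto simp: words_def)

lemma equivp_free_equiv: "equivp (\<lambda>u v. (u, v) \<in> free_equiv (UNIV :: 'a set))"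
  by (rule equivpI)
     (auto simp: reflp_def symp_def transp_def intro: free_equiv_refl free_equiv_sym free_equiv_trans)

quotient_type 'a fg = "'a word" / "\<lambda>u v. (u, v) \<in> free_equiv UNIV"
  by (rule equivp_free_equiv)

lemma free_equiv_inv_word:
  assumes "(u, v) \<in> free_equiv A"
  shows "(inv_word u, inv_word v) \<in> free_equiv A"
proof -
  have w: "u \<in> words A" "v \<in> words A"
    using assms by (auto dest: free_equiv_words)
  have "(inv_word u @ u, inv_word u @ v) \<in> free_equiv A"
    using w by (intro free_equiv_append assms free_equiv_refl) simp
  from free_equiv_trans[OF free_equiv_sym[OF this] free_equiv_inv[OF w(1)]]
  have "((inv_word u @ v) @ inv_word v, [] @ inv_word v) \<in> free_equiv A"
    using w by (intro free_equiv_append free_equiv_refl) auto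
  moreover have "(inv_word u @ (v @ inv_word v), inv_word u @ []) \<in> free_equiv A"
    using w free_equiv_inv[of "inv_word v" A] by (intro free_equiv_append free_equiv_refl) auto
  ultimately show ?thesis
    using free_equiv_trans[OF free_equiv_sym] by fastforce
qed

instantiation fg :: (type) group_add
begin

lift_definition zero_fg :: "'a fg" is "[]" .
lift_definition plus_fg :: "'a fg \<Rightarrow> 'a fg \<Rightarrow> 'a fg" is "(@)"
  by (rule free_equiv_append)
lift_definition uminus_fg :: "'a fg \<Rightarrow> 'a fg" is inv_word
  by (rule free_equiv_inv_word)
definition minus_fg :: "'a fg \<Rightarrow> 'a fg \<Rightarrow> 'a fg" where
  "minus_fg x y = x + - y"

instance
proof
  fix x y z :: "'a fg"
  show "x + y + z = x + (y + z)"
    by transfer (simp add: free_equiv_refl)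
  show "0 + x = x" "x + 0 = x"
    by (transfer, simp add: free_equiv_refl)+
  show "- x + x = 0"
    by transfer (simp add: free_equiv_inv)
  show "x + - y = x - y"
    by (simp add: minus_fg_def)
qed

end

lift_definition fg_gen :: "'a \<Rightarrow> 'a fg" is "\<lambda>x. [(x, True)]" .

lemma eval_fg_gen: "eval_word fg_gen w = abs_fg w"
proof (induction w)
  case (Cons x w)
  have "letter_value fg_gen x = abs_fg [x]"
    by (cases x) (auto simp: letter_value_def fg_gen.abs_eq uminus_fg.abs_eq inv_letter_def)
  then show ?case using Cons by (simp add: plus_fg.abs_eq)
qed (simp add: zero_fg.abs_eq)

section \<open>Substitution of words for letters\<close>

definition subst_word :: "('b \<Rightarrow> 'a word) \<Rightarrow> 'b word \<Rightarrow> 'a word" where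
  "subst_word f w = concat (map (\<lambda>x. if snd x then f (fst x) else inv_word (f (fst x))) w)"

lemma subst_word_simps [simp]:
  "subst_word f [] = []"
  "subst_word f (x # w) = (if snd x then f (fst x) else inv_word (f (fst x))) @ subst_word f w"
  "subst_word f (u @ v) = subst_word f u @ subst_word f v"
  by (simp_all add: subst_word_def)

lemma subst_word_inv_word [simp]: "subst_word f (inv_word w) = inv_word (subst_word f w)"
  by (induction w) (auto simp: inv_letter_def)

lemma subst_word_in_words:
  "w \<in> words A \<Longrightarrow> (\<And>x. x \<in> A \<Longrightarrow> f x \<in> words B) \<Longrightarrow> subst_word f w \<in> words B"
  by (induction w) auto

lemma subst_word_subst_word:
  "subst_word f (subst_word h w) = subst_word (\<lambda>x. subst_word f (h x)) w"
  by (induction w) auto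

lemma eval_word_subst_word:
  "eval_word h (subst_word f w) = eval_word (\<lambda>x. eval_word h (f x)) w"
  by (induction w) (auto simp: letter_value_def)

lemma length_subst_word:
  "w \<in> words A \<Longrightarrow> (\<And>x. x \<in> A \<Longrightarrow> length (f x) \<le> L) \<Longrightarrow> length (subst_word f w) \<le> L * length w"
  by (induction w) (auto simp: add_le_mono)

lemma free_equiv_subst_word:
  assumes "(u, v) \<in> free_equiv A" and f: "\<And>x. x \<in> A \<Longrightarrow> f x \<in> words B"
  shows "(subst_word f u, subst_word f v) \<in> free_equiv B"
proof -
  have "(u, v) \<in> (free_move A)\<^sup>*" "u \<in> words A"
    using assms(1) by (auto simp: free_equiv_def)
  from this(1) show ?thesis
  proof (induction rule: rtrancl_induct)
    case base
    have "subst_word f u \<in> words B"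
      using \<open>u \<in> words A\<close> f by (rule subst_word_in_words)
    then show ?case by (rule free_equiv_refl)
  next
    case (step v w)
    have red: "(subst_word f v, subst_word f w) \<in> free_equiv B"
      if vw: "(v, w) \<in> free_reduction" "v \<in> words A" "w \<in> words A" for v w
    proof -
      obtain p x q where *: "v = p @ [x, inv_letter x] @ q" "w = p @ q"
        using vw(1) unfolding free_reduction_def by blast
      let ?y = "subst_word f [x]"
      have "?y \<in> words B" using vw(2) * f by auto
      then have "(?y @ inv_word ?y, []) \<in> free_equiv B"
        using free_equiv_inv[of "inv_word ?y" B] by simp
      moreover have "subst_word f p \<in> words B" "subst_word f q \<in> words B"
        using vw * f by (auto intro: subst_word_in_words)
      ultimately have "(subst_word f p @ (?y @ inv_word ?y) @ subst_word f q,
          subst_word f p @ [] @ subst_word f q) \<in> free_equiv B"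
        by (rule free_equiv_ctx)
      then show ?thesis using * by (auto simp: inv_letter_def)
    qed
    then have "(subst_word f v, subst_word f w) \<in> free_equiv B"
      using step(2) red[of v w] free_equiv_sym[OF red[of w v]] by (auto simp: free_move_def)
    with step.IH show ?case by (rule free_equiv_trans)
  qed
qed

text \<open>The free group on \<open>A\<close> embeds into the one on the whole type: deleting the
  letters outside \<open>A\<close> fixes the words on \<open>A\<close> and carries a chain of free
  moves on all letters to one on \<open>A\<close>.\<close>

lemma free_equiv_iff_eval:
  assumes "u \<in> words A" "v \<in> words A"
  shows "(u, v) \<in> free_equiv A \<longleftrightarrow> eval_word fg_gen u = eval_word fg_gen v"
proof
  assume "eval_word fg_gen u = eval_word fg_gen v"
  then have uv: "(u, v) \<in> free_equiv UNIV"
    by (simp add: eval_fg_gen fg.abs_eq_iff)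
  let ?f = "\<lambda>x. if x \<in> A then [(x, True)] else []"
  have id: "subst_word ?f w = w" if "w \<in> words A" for w
    using that by (induction w) (auto simp: inv_letter_def)
  have "(subst_word ?f u, subst_word ?f v) \<in> free_equiv A"
    by (rule free_equiv_subst_word[OF uv]) auto
  then show "(u, v) \<in> free_equiv A" by (simp only: id assms)
qed (rule eval_word_free_equiv)

lemma eval_word_null: "eval_word fg_gen w = 0 \<Longrightarrow> eval_word f w = 0"
  using free_equiv_iff_eval[of w UNIV "[]"] eval_word_free_equiv[of w "[]" UNIV f] by simp

lemma exponent_sum_null: "eval_word fg_gen w = 0 \<Longrightarrow> exponent_sum w = 0"
  using free_equiv_iff_eval[of w UNIV "[]"] exponent_sum_free_equiv[of w "[]" UNIV] by simp

lemma eval_fg_gen_surj: "\<exists>w. eval_word fg_gen w = x"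
  by (induction x rule: fg.abs_induct) (auto simp: eval_fg_gen)

text \<open>This turns area in the free group into cost in another presentation. Each conjugate of a
  relator is removed at cost at most \<open>C\<close>, with free moves in between. The induction is
  on group elements, so it covers every word representing the element.\<close>

lemma null_area_converts:
  assumes f: "\<And>x. f x \<in> words A"
    and rel: "\<And>w. w \<in> Q \<union> inv_word ` Q \<Longrightarrow> \<exists>m\<le>C. converts A R (subst_word f w) m []"
    and "null_area (eval_word fg_gen ` Q) k (eval_word fg_gen w)"
  shows "\<exists>m\<le>C * k. converts A R (subst_word f w) m []"
proof -
  have fw: "subst_word f v \<in> words A" for v
    using subst_word_in_words[of v UNIV f A] f by simp
  have cong: "converts A R (subst_word f u) 0 (subst_word f v)"
    if "eval_word fg_gen u = eval_word fg_gen v" for u v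
    using that free_equiv_iff_eval[of u UNIV v] f
    by (intro converts_free_equiv free_equiv_subst_word) auto
  have "\<forall>w. eval_word fg_gen w = x \<longrightarrow> (\<exists>m\<le>C * k. converts A R (subst_word f w) m [])"
    if "null_area (eval_word fg_gen ` Q) k x" for k x
    using that
  proof (induction rule: null_area.induct)
    case (null_area_zero m)
    then show ?case using cong[of _ "[]"] by (metis subst_word_simps(1) eval_word_simps(1) le0)
  next
    case (null_area_step k x r g)
    obtain u where u: "eval_word fg_gen u = x" using eval_fg_gen_surj by blast
    obtain v where v: "eval_word fg_gen v = g" using eval_fg_gen_surj by blast
    from null_area_step.hyps(2) obtain q where
      q: "q \<in> Q \<union> inv_word ` Q" "eval_word fg_gen q = r"
    proof
      assume "- r \<in> eval_word fg_gen ` Q"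
      then obtain q where "q \<in> Q" "- r = eval_word fg_gen q" by blast
      then have "eval_word fg_gen (inv_word q) = r" by (metis eval_word_inv_word minus_minus)
      with \<open>q \<in> Q\<close> that show ?thesis by blast
    qed (use that in auto)
    obtain m where m: "m \<le> C * k" "converts A R (subst_word f u) m []"
      using null_area_step.IH u by blast
    obtain l where l: "l \<le> C" "converts A R (subst_word f q) l []"
      using rel[OF q(1)] by blast
    show ?case
    proof (intro allI impI)
      fix w assume w: "eval_word fg_gen w = g + r - g + x"
      have 1: "converts A R (subst_word f w) 0 (subst_word f (v @ q @ inv_word v @ u))"
        by (rule cong) (simp add: w u v q add.assoc diff_conv_add_uminus del: add_uminus_conv_diff)
      have 2: "converts A R (subst_word f v @ subst_word f q @ (inv_word (subst_word f v) @ subst_word f u)) l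
          (subst_word f v @ [] @ (inv_word (subst_word f v) @ subst_word f u))"
        by (rule converts_ctx[OF l(2)]) (use fw in auto)
      have 3: "converts A R (subst_word f (v @ inv_word v @ u)) 0 (subst_word f u)"
        by (rule cong) (simp add: add.assoc[symmetric])
      have "converts A R (subst_word f w) (0 + (l + (0 + m))) []"
        by (rule converts_trans[OF converts_trans[OF converts_trans[OF m(2) 3]] 1]) (use 2 in simp)
      moreover have "0 + (l + (0 + m)) \<le> C * Suc k" using l(1) m(1) by simp
      ultimately show "\<exists>m\<le>C * Suc k. converts A R (subst_word f w) m []" by blast
    qed
  qed
  with assms(3) show ?thesis by blast
qed

section \<open>The group of Stallings inside the product of free groups\<close>

type_synonym product_fg = "generator fg \<times> generator fg \<times> generator fg"

fun fg_product_gen :: "generator \<Rightarrow> product_fg" where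
  "fg_product_gen Alpha = (fg_gen Alpha, 0, 0)"
| "fg_product_gen Beta = (fg_gen Beta, 0, 0)"
| "fg_product_gen Gamma = (0, fg_gen Gamma, 0)"
| "fg_product_gen Delta = (0, fg_gen Delta, 0)"
| "fg_product_gen Epsilon = (0, 0, fg_gen Epsilon)"
| "fg_product_gen Zeta = (0, 0, fg_gen Zeta)"

fun stallings_word :: "stallings_gen \<Rightarrow> generator word" where
  "stallings_word GA = [(Epsilon, True), (Alpha, False)]"
| "stallings_word GB = [(Epsilon, True), (Beta, False)]"
| "stallings_word GC = [(Epsilon, True), (Gamma, False)]"
| "stallings_word GD = [(Epsilon, True), (Delta, False)]"
| "stallings_word GS = [(Zeta, True), (Epsilon, False)]"

definition stallings_value :: "stallings_gen \<Rightarrow> product_fg" where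
  "stallings_value x = eval_word fg_product_gen (stallings_word x)"

lemma eval_word_fst: "fst (eval_word f w) = eval_word (fst \<circ> f) w"
  and eval_word_snd: "snd (eval_word f w) = eval_word (snd \<circ> f) w"
  by (induction w) (auto simp: letter_value_def)

lemma zmul_Pair: "zmul i (x, y) = (zmul i x, zmul i y)"
proof -
  have "((+) (x, y) ^^ n) 0 = (((+) x ^^ n) 0, ((+) y ^^ n) 0)" for n and x :: 'a and y :: 'b
    by (induction n) (auto simp: zero_prod_def)
  then show ?thesis by (simp add: zmul_def)
qed

lemma zmul_zero [simp]: "zmul i 0 = 0"
  by (induction i rule: int_induct[where k = 0])
     (simp_all add: zmul_pred, metis add.commute add_0 zmul_succ)

text \<open>This is Reidemeister-Schreier rewriting with the powers of \<epsilon> as coset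
  representatives. The generators of the first two factors commute with \<epsilon> and give the
  inverse of one of \<open>a\<close>, \<open>b\<close>, \<open>c\<close>, \<open>d\<close>. For
  \<zeta>, conjugating \<open>s\<close> by a power of \<epsilon> is the same as conjugating it by
  that power of \<open>a\<close>.\<close>

lemma generator_step: "\<exists>v. zmul i (fg_product_gen Epsilon) + fg_product_gen x
    - zmul (1 + i) (fg_product_gen Epsilon) = eval_word stallings_value v"
proof -
  let ?e = "fg_gen Epsilon"
  have "zmul i ?e + ?e = ?e + zmul i ?e"
    using zmul_add[of i 1 ?e] zmul_succ[of i ?e] by (simp add: add.commute)
  then have comm: "- zmul i ?e + - ?e = - ?e + - zmul i ?e"
    by (metis minus_add)
  then have comm': "zmul i ?e + (- ?e + - zmul i ?e) = - ?e"
    by (metis add_minus_cancel)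
  define v where "v = (case x of
      Alpha \<Rightarrow> [(GA, False)] | Beta \<Rightarrow> [(GB, False)]
    | Gamma \<Rightarrow> [(GC, False)] | Delta \<Rightarrow> [(GD, False)] | Epsilon \<Rightarrow> []
    | Zeta \<Rightarrow> power_word GA i @ [(GS, True)] @ power_word GA (- i))"
  have "zmul i (fg_product_gen Epsilon) + fg_product_gen x
      - zmul (1 + i) (fg_product_gen Epsilon) = eval_word stallings_value v"
    by (cases x)
       (simp_all add: v_def stallings_value_def letter_value_def zmul_Pair zmul_succ zmul_uminus
          add.assoc diff_conv_add_uminus minus_add zero_prod_def comm comm'
          del: add_uminus_conv_diff)
  then show ?thesis by blast
qed

lemma stallings_generates:
  "\<exists>v. eval_word fg_product_gen w
    = eval_word stallings_value v + zmul (exponent_sum w) (fg_product_gen Epsilon)"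
proof (induction w rule: rev_induct)
  case Nil
  show ?case by (rule exI[of _ "[]"]) simp
next
  case (snoc x w)
  let ?e = "fg_product_gen Epsilon" and ?x = "fg_product_gen (fst x)" and ?i = "exponent_sum w"
  obtain v where v: "eval_word fg_product_gen w = eval_word stallings_value v + zmul ?i ?e"
    using snoc by blast
  show ?case
  proof (cases "snd x")
    case True
    obtain u where u: "zmul ?i ?e + ?x - zmul (1 + ?i) ?e = eval_word stallings_value u"
      using generator_step by blast
    have "eval_word fg_product_gen (w @ [x])
        = eval_word stallings_value (v @ u) + zmul (exponent_sum (w @ [x])) ?e"
      using True v u[symmetric]
      by (simp add: letter_value_def add.assoc diff_conv_add_uminus add.commute[of _ 1]
          del: add_uminus_conv_diff)
    then show ?thesis by blast
  next
    case False
    \<comment> \<open>A negative letter undoes the step that starts one level lower.\<close>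
    obtain u where u: "zmul (?i - 1) ?e + ?x - zmul ?i ?e = eval_word stallings_value u"
      using generator_step[of "?i - 1"] by auto
    have "eval_word fg_product_gen (w @ [x])
        = eval_word stallings_value (v @ inv_word u) + zmul (exponent_sum (w @ [x])) ?e"
      using False v u[symmetric]
      by (simp add: letter_value_def add.assoc diff_conv_add_uminus minus_add
          del: add_uminus_conv_diff)
    then show ?thesis by blast
  qed
qed

section \<open>Comparison of the two forms of the product\<close>

definition fg_of_class :: "'a word set \<Rightarrow> 'a fg" where
  "fg_of_class X = eval_word fg_gen (SOME w. w \<in> X)"

lemma fg_of_class_free_class:
  assumes "w \<in> words A"
  shows "fg_of_class (free_class A w) = eval_word fg_gen w"
proof -
  have "w \<in> free_class A w" using assms by (simp add: free_class_def free_equiv_refl)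
  then have "(SOME v. v \<in> free_class A w) \<in> free_class A w" by (metis someI)
  then have "(w, SOME v. v \<in> free_class A w) \<in> free_equiv A"
    by (simp add: free_class_def)
  then show ?thesis
    unfolding fg_of_class_def by (metis eval_word_free_equiv)
qed

definition fg_of_product ::
    "generator word set \<times> generator word set \<times> generator word set \<Rightarrow> product_fg" where
  "fg_of_product = (\<lambda>(x, y, z). (fg_of_class x, fg_of_class y, fg_of_class z))"

definition restrict_word :: "'a set \<Rightarrow> 'a word \<Rightarrow> 'a word" where
  "restrict_word A w = filter (\<lambda>x. fst x \<in> A) w"

lemma restrict_word_simps [simp]:
  "restrict_word A [] = []"
  "restrict_word A (x # w) = (if fst x \<in> A then x # restrict_word A w else restrict_word A w)"
  "restrict_word A (u @ v) = restrict_word A u @ restrict_word A v"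
  by (simp_all add: restrict_word_def)

lemma restrict_word_in_words [simp]: "restrict_word A w \<in> words A"
  by (induction w) auto

lemma restrict_word_id: "w \<in> words A \<Longrightarrow> restrict_word A w = w"
  by (induction w) auto

lemma restrict_word_disjoint: "w \<in> words A \<Longrightarrow> A \<inter> B = {} \<Longrightarrow> restrict_word B w = []"
  by (induction w) auto

definition product_class ::
    "generator word \<Rightarrow> generator word set \<times> generator word set \<times> generator word set" where
  "product_class w = (free_class {Alpha, Beta} (restrict_word {Alpha, Beta} w),
     free_class {Gamma, Delta} (restrict_word {Gamma, Delta} w),
     free_class {Epsilon, Zeta} (restrict_word {Epsilon, Zeta} w))"

lemma product_class_append:
  "product_class (u @ v) = product_class u \<otimes>\<^bsub>free_product3\<^esub> product_class v"
  by (simp add: product_class_def free_product3_def)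

lemma carrier_free_product3: "carrier free_product3 = range product_class"
proof
  show "range product_class \<subseteq> carrier free_product3"
    by (auto simp: product_class_def free_product3_def)
  show "carrier free_product3 \<subseteq> range product_class"
  proof
    fix t assume "t \<in> carrier free_product3"
    then obtain u v w where t: "t = (free_class {Alpha, Beta} u, free_class {Gamma, Delta} v,
        free_class {Epsilon, Zeta} w)" "u \<in> words {Alpha, Beta}" "v \<in> words {Gamma, Delta}"
        "w \<in> words {Epsilon, Zeta}"
      by (auto simp: free_product3_def carrier_free_group)
    then have "t = product_class (u @ v @ w)"
      by (simp add: product_class_def restrict_word_id restrict_word_disjoint)
    then show "t \<in> range product_class" by blast
  qed
qed

lemma fg_of_product_class: "fg_of_product (product_class w) = eval_word fg_product_gen w"
proof -
  have "eval_word fg_product_gen w = (eval_word fg_gen (restrict_word {Alpha, Beta} w),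
     eval_word fg_gen (restrict_word {Gamma, Delta} w),
     eval_word fg_gen (restrict_word {Epsilon, Zeta} w))"
  proof (induction w)
    case (Cons x w)
    then show ?case by (cases "fst x") (simp_all add: letter_value_def)
  qed (simp add: zero_prod_def)
  then show ?thesis
    by (simp add: fg_of_product_def product_class_def fg_of_class_free_class)
qed

lemma inj_fg_of_product: "inj_on fg_of_product (carrier free_product3)"
proof (rule inj_onI)
  fix s t assume "s \<in> carrier free_product3" "t \<in> carrier free_product3"
    and eq: "fg_of_product s = fg_of_product t"
  then obtain u v where "s = product_class u" "t = product_class v"
    unfolding carrier_free_product3 by blast
  then show "s = t"
    using eq by (simp add: product_class_def fg_of_product_def fg_of_class_free_class
        free_class_eq_iff free_equiv_iff_eval)
qed

lemma fg_of_product_mult: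
  assumes "s \<in> carrier free_product3" "t \<in> carrier free_product3"
  shows "fg_of_product (s \<otimes>\<^bsub>free_product3\<^esub> t) = fg_of_product s + fg_of_product t"
proof -
  obtain u v where "s = product_class u" "t = product_class v"
    using assms unfolding carrier_free_product3 by blast
  then show ?thesis
    by (simp flip: product_class_append add: fg_of_product_class)
qed

text \<open>The values at the generators determine \<open>\<phi>\<close>, so it is the exponent sum
  and its kernel does not depend on the choice of \<open>\<phi>\<close>.\<close>

lemma hom_product_class:
  assumes \<phi>: "\<phi> \<in> hom free_product3 integer_group" and gen: "\<And>g. \<phi> (product_gen g) = 1"
  shows "\<phi> (product_class w) = exponent_sum w"
proof -
  have mult: "\<phi> (product_class (u @ v)) = \<phi> (product_class u) + \<phi> (product_class v)" for u v
    using hom_mult[OF \<phi>, of "product_class u" "product_class v"]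
    by (simp add: product_class_append carrier_free_product3)
  have Nil: "\<phi> (product_class []) = 0"
    using mult[of "[]" "[]"] by simp
  have pos: "\<phi> (product_class [(g, True)]) = 1" for g
  proof -
    have "product_class [(g, True)] = product_gen g"
      by (cases g) (simp_all add: product_class_def free_gen_def)
    then show ?thesis by (simp add: gen)
  qed
  have neg: "\<phi> (product_class [(g, False)]) = - 1" for g
  proof -
    \<comment> \<open>The cancelling pair is compared with the empty word after applying
      \<open>fg_of_product\<close>, which is injective.\<close>
    have "fg_of_product (product_class ([(g, True)] @ [(g, False)])) = fg_of_product (product_class [])"
      by (simp add: fg_of_product_class letter_value_def)
    then have "product_class ([(g, True)] @ [(g, False)]) = product_class []"
      using inj_fg_of_product carrier_free_product3 by (auto simp: inj_on_def)
    then show ?thesis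
      using mult[of "[(g, True)]" "[(g, False)]"] by (simp add: pos Nil)
  qed
  show ?thesis
  proof (induction w)
    case (Cons x w)
    have "\<phi> (product_class [x]) = (if snd x then 1 else - 1)"
      using pos neg by (cases x) auto
    then show ?case using Cons mult[of "[x]" w] by simp
  qed (simp add: Nil)
qed

text \<open>The abstract isomorphism is replaced by an assignment \<open>q\<close> of values to the
  letters of \<open>A\<close>. The three facts say that \<open>q\<close> detects the null words,
  that its values lie in the subgroup generated by \<open>a\<close>, \<open>b\<close>,
  \<open>c\<close>, \<open>d\<close>, \<open>s\<close>, and that words in them reach all five
  generators.\<close>

lemma presentation_evaluation:
  assumes \<phi>: "\<phi> \<in> hom free_product3 integer_group" "\<And>g. \<phi> (product_gen g) = 1"
    and pres: "finite_presentation A R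
           (free_product3\<lparr>carrier := kernel free_product3 integer_group \<phi>\<rparr>)"
  obtains q where "\<And>w. w \<in> words A \<Longrightarrow> eval_word q w = 0 \<longleftrightarrow> w \<in> null_words A R"
    and "\<And>x. x \<in> A \<Longrightarrow> \<exists>v. q x = eval_word stallings_value v"
    and "\<And>y. \<exists>w\<in>words A. eval_word q w = stallings_value y"
proof -
  let ?F = "free_group A" and ?P = "presented_group A R"
  let ?K = "kernel free_product3 integer_group \<phi>"
  have R: "R \<subseteq> words A" using pres by (simp add: finite_presentation_def)
  interpret N: normal "relator_closure A R" ?F by (rule normal_relator_closure[OF R])
  interpret P: group ?P
    unfolding presented_group_def by (rule N.factorgroup_is_group)
  obtain h where h: "h \<in> hom ?P (free_product3\<lparr>carrier := ?K\<rparr>)" "bij_betw h (carrier ?P) ?K"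
    using pres by (auto simp: finite_presentation_def is_iso_def iso_def)
  have K: "?K = product_class ` {w. exponent_sum w = 0}"
    by (auto simp: kernel_def carrier_free_product3 hom_product_class[OF \<phi>])
  have Kc: "?K \<subseteq> carrier free_product3" by (auto simp: kernel_def)
  have val: "word_value A R w \<in> carrier ?P" if "w \<in> words A" for w
    using that N.rcosetsI[OF N.subset] by (simp add: word_value_def presented_group_def FactGroup_def)
  have val_mult: "word_value A R (u @ v) = word_value A R u \<otimes>\<^bsub>?P\<^esub> word_value A R v"
    if "u \<in> words A" "v \<in> words A" for u v
    using that hom_mult[OF N.r_coset_hom_Mod, of "free_class A u" "free_class A v"]
    by (simp add: word_value_def presented_group_def)
  define k where "k = (\<lambda>w. fg_of_product (h (word_value A R w)))"
  have hK: "h (word_value A R w) \<in> ?K" if "w \<in> words A" for w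
    using val[OF that] h(2) by (auto simp: bij_betw_def)
  have k_append: "k (u @ v) = k u + k v" if "u \<in> words A" "v \<in> words A" for u v
  proof -
    have "h (word_value A R (u @ v)) = h (word_value A R u) \<otimes>\<^bsub>free_product3\<^esub> h (word_value A R v)"
      using hom_mult[OF h(1) val[OF that(1)] val[OF that(2)]] val_mult[OF that] by simp
    moreover have "h (word_value A R u) \<in> carrier free_product3" "h (word_value A R v) \<in> carrier free_product3"
      using hK that Kc by blast+
    ultimately show ?thesis
      by (simp add: k_def fg_of_product_mult)
  qed
  have "k [] + k [] = k [] + 0" using k_append[of "[]" "[]"] by simp
  then have k_Nil: "k [] = 0" by (simp only: add_left_cancel)
  have k_cong: "word_value A R u = word_value A R v"
    if "u \<in> words A" "v \<in> words A" "k u = k v" for u v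
  proof -
    have "h (word_value A R u) = h (word_value A R v)"
      using that(3) hK[OF that(1)] hK[OF that(2)] Kc inj_onD[OF inj_fg_of_product]
      unfolding k_def by blast
    then show ?thesis
      using h(2) val[OF that(1)] val[OF that(2)] unfolding bij_betw_def by (meson inj_onD)
  qed
  define q where "q = (\<lambda>x. k [(x, True)])"
  have k_inv: "k [(x, False)] = - q x" if "x \<in> A" for x
  proof -
    have "word_value A R [(x, True), (x, False)] = word_value A R []"
    proof -
      have "free_class A [(x, True), (x, False)] = free_class A []"
        using that by (simp add: free_class_eq_iff free_equiv_iff_eval letter_value_def)
      then show ?thesis by (simp add: word_value_def)
    qed
    then have "k ([(x, True)] @ [(x, False)]) = 0"
      using k_Nil by (simp add: k_def)
    then have "q x + k [(x, False)] = 0"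
      using that k_append[of "[(x, True)]" "[(x, False)]"] by (simp add: q_def)
    from minus_unique[OF this] show ?thesis by simp
  qed
  have kq: "eval_word q w = k w" if "w \<in> words A" for w
    using that
  proof (induction w)
    case (Cons x w)
    have "letter_value q x = k [x]"
      using Cons.prems k_inv by (cases x) (auto simp: letter_value_def q_def)
    then show ?case
      using Cons k_append[of "[x]" w] by simp
  qed (simp add: k_Nil)
  show thesis
  proof
    fix w assume w: "w \<in> words A"
    have one: "word_value A R [] = \<one>\<^bsub>?P\<^esub>"
      using Nil_null_word[OF R] by (simp add: null_words_def)
    have "eval_word q w = 0 \<longleftrightarrow> k w = k []"
      using w by (simp add: kq k_Nil)
    also have "\<dots> \<longleftrightarrow> word_value A R w = word_value A R []"
      using k_cong[of w "[]"] w by (auto simp: k_def)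
    finally show "eval_word q w = 0 \<longleftrightarrow> w \<in> null_words A R"
      using w one by (simp add: null_words_def)
  next
    fix x assume "x \<in> A"
    then have "h (word_value A R [(x, True)]) \<in> ?K" by (intro hK) simp
    then obtain w where w: "exponent_sum w = 0" "h (word_value A R [(x, True)]) = product_class w"
      unfolding K by blast
    then show "\<exists>v. q x = eval_word stallings_value v"
      using stallings_generates[of w] by (simp add: q_def k_def fg_of_product_class)
  next
    fix y
    have "exponent_sum (stallings_word y) = 0" by (cases y) auto
    then have "product_class (stallings_word y) \<in> h ` carrier ?P"
      unfolding bij_betw_imp_surj_on[OF h(2)] K by blast
    then obtain X where X: "X \<in> carrier ?P" "h X = product_class (stallings_word y)"
      by (metis imageE)
    then obtain w where w: "w \<in> words A" "X = word_value A R w"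
      by (auto simp: presented_group_def FactGroup_def RCOSETS_def carrier_free_group word_value_def)
    then show "\<exists>w\<in>words A. eval_word q w = stallings_value y"
      using X(2) by (intro bexI[OF _ w(1)]) (simp add: kq k_def fg_of_product_class stallings_value_def)
  qed
qed

section \<open>The isoperimetric function\<close>

text \<open>These eight words realise the assumptions of \<open>stallings_relations\<close>; the
  equations s^a = s^b and s^c = s^d follow from them.\<close>

definition relator_words :: "stallings_gen word set" where
  "relator_words = (\<Union>x\<in>{GA, GB}. \<Union>y\<in>{GC, GD}.
     {[(x, True), (y, True)] @ inv_word [(y, True), (x, True)],
      [(x, True), (y, False), (GS, True)] @ inv_word [(GS, True), (x, True), (y, False)]})"

lemma relator_words_value: "w \<in> relator_words \<Longrightarrow> eval_word stallings_value w = 0"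
  by (auto simp: relator_words_def stallings_value_def letter_value_def inv_letter_def zero_prod_def
      add.assoc diff_conv_add_uminus minus_add simp del: add_uminus_conv_diff)

interpretation fg: stallings_relations "eval_word fg_gen ` relator_words" fg_gen
proof
  let ?R = "eval_word fg_gen ` relator_words"
  have rel: "cost_eq ?R 1 x y" if "x - y \<in> ?R" for x y
    using null_area_step[OF null_area_zero[of ?R 0], of "x - y" 0] that
    by (simp add: cost_eq_def)
  fix x y assume "x \<in> {GA, GB}" "y \<in> {GC, GD}"
  then have mem: "[(x, True), (y, True)] @ inv_word [(y, True), (x, True)] \<in> relator_words"
    "[(x, True), (y, False), (GS, True)] @ inv_word [(GS, True), (x, True), (y, False)] \<in> relator_words"
    by (auto simp: relator_words_def)
  show "cost_comm ?R 1 (fg_gen x) (fg_gen y)"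
    unfolding cost_comm_def
    by (rule rel, rule image_eqI[OF _ mem(1)])
       (simp add: letter_value_def inv_letter_def add.assoc diff_conv_add_uminus minus_add
          del: add_uminus_conv_diff)
  show "cost_comm ?R 1 (fg_gen x - fg_gen y) (fg_gen GS)"
    unfolding cost_comm_def
    by (rule rel, rule image_eqI[OF _ mem(2)])
       (simp add: letter_value_def inv_letter_def add.assoc diff_conv_add_uminus minus_add
          del: add_uminus_conv_diff)
qed

text \<open>The spine is recovered from the third component of the value of \<open>w\<close>: substituting \<open>c\<close> for \<open>\<epsilon>\<close> and
  \<open>s + c\<close> for \<open>\<zeta>\<close> turns \<open>a, b, c, d\<close> into \<open>c\<close> and \<open>s\<close> into \<open>s\<close>.\<close>

lemma stallings_word_problem:
  assumes "eval_word stallings_value w = 0"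
  shows "eval_word fg_gen (ab_part w) = 0" "eval_word fg_gen (cd_part w) = 0" "fg.spine GC w = 0"
proof -
  \<comment> \<open>A freely trivial word stays trivial under every assignment \<open>l\<close>, so
    it suffices to find one that recovers \<open>h\<close> from the component
    \<open>k\<close>.\<close>
  have transport: "eval_word h v = 0" if "eval_word (\<lambda>x. eval_word fg_gen (k x)) v = 0"
    and "\<And>x. h x = eval_word l (k x)"
    for h :: "stallings_gen \<Rightarrow> stallings_gen fg" and l and k :: "stallings_gen \<Rightarrow> generator word" and v
  proof -
    have "h = (\<lambda>x. eval_word l (k x))" using that(2) by (rule ext)
    then show ?thesis
      using eval_word_null[of "subst_word k v" l] that(1) by (simp add: eval_word_subst_word)
  qed
  let ?k1 = "\<lambda>x. restrict_word {Alpha, Beta} (stallings_word x)"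
    and ?k2 = "\<lambda>x. restrict_word {Gamma, Delta} (stallings_word x)"
    and ?k3 = "\<lambda>x. restrict_word {Epsilon, Zeta} (stallings_word x)"
  have k: "(fst \<circ> stallings_value) = (\<lambda>x. eval_word fg_gen (?k1 x))"
    "(fst \<circ> (snd \<circ> stallings_value)) = (\<lambda>x. eval_word fg_gen (?k2 x))"
    "(snd \<circ> (snd \<circ> stallings_value)) = (\<lambda>x. eval_word fg_gen (?k3 x))"
    by (rule ext, rename_tac x, case_tac x, simp_all add: stallings_value_def letter_value_def)+
  have z: "eval_word (\<lambda>x. eval_word fg_gen (?k1 x)) w = 0"
    "eval_word (\<lambda>x. eval_word fg_gen (?k2 x)) w = 0"
    "eval_word (\<lambda>x. eval_word fg_gen (?k3 x)) w = 0"
    unfolding k[symmetric] eval_word_fst[symmetric] eval_word_snd[symmetric] by (simp_all add: assms)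
  define h1 h2 h3 where "h1 = (\<lambda>x. if x \<in> {GA, GB} then fg_gen x else 0)"
    and "h2 = (\<lambda>x. if x \<in> {GC, GD} then fg_gen x else 0)"
    and "h3 = fg_gen \<circ> collapse GC"
  \<comment> \<open>In the first component \<open>a\<close> and \<open>b\<close> are the inverses of
    \<alpha> and \<beta>, hence the minus signs.\<close>
  have "eval_word h1 w = 0"
    by (rule transport[OF z(1), of _ "case_generator (- fg_gen GA) (- fg_gen GB) 0 0 0 0"],
        rename_tac x, case_tac x) (simp_all add: h1_def letter_value_def)
  moreover have "eval_word h1 w = eval_word fg_gen (ab_part w)"
    by (induction w) (auto simp: h1_def ab_part_def letter_value_def)
  ultimately show ab: "eval_word fg_gen (ab_part w) = 0" by simp
  have "eval_word h2 w = 0"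
    by (rule transport[OF z(2), of _ "case_generator 0 0 (- fg_gen GC) (- fg_gen GD) 0 0"],
        rename_tac x, case_tac x) (simp_all add: h2_def letter_value_def)
  moreover have "eval_word h2 w = eval_word fg_gen (cd_part w)"
    by (induction w) (auto simp: h2_def cd_part_def letter_value_def)
  ultimately show cd: "eval_word fg_gen (cd_part w) = 0" by simp
  have "eval_word h3 w = 0"
    by (rule transport[OF z(3), of _ "case_generator 0 0 0 0 (fg_gen GC) (fg_gen GS + fg_gen GC)"],
        rename_tac x, case_tac x) (simp_all add: h3_def collapse_def letter_value_def)
  moreover have "height w = 0"
  proof -
    have "GS \<notin> fst ` set (strip_s w)" by (auto simp: strip_s_def)
    then show ?thesis
      using exponent_sum_ab_cd[of "strip_s w"] exponent_sum_null[OF ab] exponent_sum_null[OF cd]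
      by (simp add: height_def)
  qed
  ultimately show "fg.spine GC w = 0"
    by (simp add: fg.spine_def h3_def)
qed

section \<open>Change of presentation\<close>

lemma finite_uniform_bound:
  fixes P :: "'b \<Rightarrow> nat \<Rightarrow> bool"
  assumes "finite S" "\<And>x. x \<in> S \<Longrightarrow> \<exists>m. P x m"
  shows "\<exists>C. \<forall>x\<in>S. \<exists>m\<le>C. P x m"
proof -
  from assms(2) obtain f where f: "\<And>x. x \<in> S \<Longrightarrow> P x (f x)" by metis
  have "\<forall>x\<in>S. f x \<le> sum f S"
    using assms(1) by (simp add: member_le_sum)
  with f show ?thesis by blast
qed

lemma converts_subst_word:
  assumes f: "\<And>x. x \<in> A \<Longrightarrow> f x \<in> words A"
    and D: "\<And>x. fst x \<in> A \<Longrightarrow> \<exists>m\<le>D. converts A R [x] m (subst_word f [x])"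
    and "w \<in> words A"
  shows "\<exists>m\<le>D * length w. converts A R w m (subst_word f w)"
  using assms(3)
proof (induction w)
  case Nil
  then show ?case by (auto intro: converts_refl)
next
  case (Cons x w)
  then have x: "fst x \<in> A" and w: "w \<in> words A" by auto
  obtain l where l: "l \<le> D" "converts A R [x] l (subst_word f [x])" using D[OF x] by blast
  obtain m where m: "m \<le> D * length w" "converts A R w m (subst_word f w)" using Cons w by blast
  have "converts A R ([] @ [x] @ w) l ([] @ subst_word f [x] @ w)"
    by (rule converts_ctx[OF l(2)]) (use w in auto)
  moreover have "converts A R (subst_word f [x] @ w @ []) m (subst_word f [x] @ subst_word f w @ [])"
    by (rule converts_ctx[OF m(2)]) (use f[OF x] in auto)
  ultimately have "converts A R (x # w) (l + m) (subst_word f (x # w))"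
    using converts_trans by fastforce
  moreover have "l + m \<le> D * length (x # w)" using l(1) m(1) by simp
  ultimately show ?case by blast
qed

text \<open>\<open>t\<close> writes the letters of \<open>A\<close> in Stallings generators and
  \<open>f\<close> writes these back in \<open>A\<close>. Going there and back costs at most
  \<open>D\<close> per letter. The result is the image under \<open>f\<close> of a null word in the
  Stallings generators, and each relator in its area costs at most \<open>C\<close>.\<close>

lemma area_bound:
  assumes \<phi>: "\<phi> \<in> hom free_product3 integer_group" "\<And>g. \<phi> (product_gen g) = 1"
    and pres: "finite_presentation A R
           (free_product3\<lparr>carrier := kernel free_product3 integer_group \<phi>\<rparr>)"
  shows "\<exists>E. \<forall>m. \<forall>w\<in>null_words A R. length w \<le> m ^ 3 \<longrightarrow> area A R w \<le> E * m ^ 7"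
proof -
  obtain q where null: "\<And>w. w \<in> words A \<Longrightarrow> eval_word q w = 0 \<longleftrightarrow> w \<in> null_words A R"
    and q1: "\<And>x. x \<in> A \<Longrightarrow> \<exists>v. q x = eval_word stallings_value v"
    and q2: "\<And>y. \<exists>w\<in>words A. eval_word q w = stallings_value y"
    using presentation_evaluation[OF assms] by blast
  have A: "finite A" and R: "R \<subseteq> words A"
    using pres by (auto simp: finite_presentation_def)
  obtain t where t: "\<And>x. x \<in> A \<Longrightarrow> q x = eval_word stallings_value (t x)"
    using q1 by metis
  obtain f where f: "\<And>y. f y \<in> words A" "\<And>y. eval_word q (f y) = stallings_value y"
    using q2 by metis
  have fw: "subst_word f v \<in> words A" for v
    using subst_word_in_words[of v UNIV f A] f(1) by simp
  have ft: "eval_word q (subst_word f v) = eval_word stallings_value v" for v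
    by (simp add: eval_word_subst_word f)
  have conv: "\<exists>m. converts A R u m v"
    if "u \<in> words A" "v \<in> words A" "eval_word q u = eval_word q v" for u v
  proof -
    have "u @ inv_word v \<in> null_words A R"
      using that null[of "u @ inv_word v"] by simp
    then obtain m where "converts A R (u @ inv_word v) m []"
      using null_word_converts[OF R] by blast
    from converts_ctx[OF this, of "[]" v]
    have 1: "converts A R (u @ inv_word v @ v) m v" using that by simp
    have "(u @ inv_word v @ v, u) \<in> free_equiv A"
      using that by (simp add: free_equiv_iff_eval)
    from converts_trans[OF 1 converts_free_equiv[OF free_equiv_sym[OF this]]]
    show ?thesis by blast
  qed
  have "\<exists>C. \<forall>w\<in>relator_words \<union> inv_word ` relator_words. \<exists>m\<le>C. converts A R (subst_word f w) m []"
  proof (rule finite_uniform_bound)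
    show "finite (relator_words \<union> inv_word ` relator_words)"
      by (simp add: relator_words_def)
    show "\<exists>m. converts A R (subst_word f w) m []" if "w \<in> relator_words \<union> inv_word ` relator_words" for w
      using that relator_words_value by (intro conv fw) (auto simp: ft)
  qed
  then obtain C where C: "\<And>w. w \<in> relator_words \<union> inv_word ` relator_words \<Longrightarrow>
      \<exists>m\<le>C. converts A R (subst_word f w) m []" by blast
  let ?g = "\<lambda>x. subst_word f (t x)"
  have "\<exists>D. \<forall>x\<in>A \<times> UNIV. \<exists>m\<le>D. converts A R [x] m (subst_word ?g [x])"
  proof (rule finite_uniform_bound)
    show "\<exists>m. converts A R [x] m (subst_word ?g [x])" if "x \<in> A \<times> UNIV" for x
      using that fw by (intro conv) (auto simp: ft letter_value_def t)
  qed (use A in simp)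
  then obtain D where D: "\<And>x. fst x \<in> A \<Longrightarrow> \<exists>m\<le>D. converts A R [x] m (subst_word ?g [x])"
    by (metis UNIV_I mem_Times_iff)
  define L where "L = (\<Sum>x\<in>A. length (t x))"
  have L: "length (t x) \<le> L" if "x \<in> A" for x
    unfolding L_def using that A by (intro member_le_sum) auto
  have "area A R w \<le> (D + C * 72 * L ^ 7) * m ^ 7"
    if w: "w \<in> null_words A R" "length w \<le> m ^ 3" for m w
  proof -
    let ?v = "subst_word t w"
    have wA: "w \<in> words A" using w by (simp add: null_words_def)
    have "length ?v \<le> L * length w"
      using length_subst_word[OF wA L] .
    \<comment> \<open>Enlarging \<open>L\<close> to its cube makes the length bound the cube of
      \<open>L * m\<close>.\<close>
    also have "\<dots> \<le> L ^ 3 * m ^ 3"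
      using w(2) by (intro mult_mono) (auto simp: power3_eq_cube)
    finally have len: "length ?v \<le> (L * m) ^ 3" by (simp add: power_mult_distrib)
    have "eval_word stallings_value ?v = eval_word q w"
      unfolding eval_word_subst_word using wA by (rule eval_word_cong) (simp add: t)
    also have "\<dots> = 0" using null[OF wA] w(1) by simp
    finally have "null_area (eval_word fg_gen ` relator_words) (72 * (L * m) ^ 7) (eval_word fg_gen ?v)"
      using fg.null_area_7_3[OF len] stallings_word_problem[of ?v] by simp
    from null_area_converts[OF f(1) C this]
    obtain k where k: "k \<le> C * (72 * (L * m) ^ 7)" "converts A R (subst_word f ?v) k []"
      by blast
    obtain l where l: "l \<le> D * length w" "converts A R w l (subst_word ?g w)"
      using converts_subst_word[OF fw D wA] by blast
    have "converts A R w (l + k) []"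
      using converts_trans[OF k(2)] l(2) by (simp add: subst_word_subst_word)
    then have "area A R w \<le> l + k"
      unfolding area_def by (rule Least_le)
    also have "m ^ 3 \<le> m ^ 7" by (cases "m = 0") (auto intro: power_increasing)
    then have "D * length w \<le> D * m ^ 7" using w(2) by (intro mult_left_mono) auto
    then have "l + k \<le> D * m ^ 7 + C * (72 * (L * m) ^ 7)" using l(1) k(1) by linarith
    also have "\<dots> = (D + C * 72 * L ^ 7) * m ^ 7"
      by (simp add: power_mult_distrib algebra_simps)
    finally show ?thesis .
  qed
  then show ?thesis by blast
qed

theorem theorem1:
  fixes \<phi> :: "generator word set \<times> generator word set \<times> generator word set \<Rightarrow> int"
    and A :: "'a set" and R :: "'a word set"
  assumes "\<phi> \<in> hom free_product3 integer_group"
    and "\<And>g. \<phi> (product_gen g) = 1"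
    and "finite_presentation A R
           (free_product3\<lparr>carrier := kernel free_product3 integer_group \<phi>\<rparr>)"
  shows "\<exists>K::real. K > 0 \<and> (\<forall>n::nat. real (dehn_function A R n) \<le> K * real n powr (7 / 3))"
proof -
  obtain E where E: "\<And>m w. w \<in> null_words A R \<Longrightarrow> length w \<le> m ^ 3 \<Longrightarrow> area A R w \<le> E * m ^ 7"
    using area_bound[OF assms] by blast
  have A: "finite A" and R: "R \<subseteq> words A"
    using assms(3) by (auto simp: finite_presentation_def)
  have dehn: "dehn_function A R n \<le> E * m ^ 7" if "n \<le> m ^ 3" for n m
    unfolding dehn_function_def
  proof (rule Max.boundedI)
    show "finite (area A R ` {w \<in> null_words A R. length w \<le> n})"
      using finite_short_null_words[OF A] by simp
    show "area A R ` {w \<in> null_words A R. length w \<le> n} \<noteq> {}"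
      using Nil_null_word[OF R] by auto
  qed (use E that in fastforce)
  have "real (dehn_function A R n) \<le> (128 * real E + 1) * real n powr (7 / 3)" for n
  proof -
    let ?r = "real n powr (1 / 3)"
    \<comment> \<open>Rounding up the cube root puts \<open>n\<close> below a cube. For positive
      \<open>n\<close> this at most doubles the root, and 128 is the seventh power of 2. For
      \<open>n = 0\<close> the convention \<open>0 powr x = 0\<close> gives
      \<open>m = 0\<close>.\<close>
    define m where "m = nat \<lceil>?r\<rceil>"
    have r3: "?r ^ 3 = real n" and r7: "?r ^ 7 = real n powr (7 / 3)"
      by (cases "n = 0"; simp add: powr_powr flip: powr_realpow)+
    have "?r \<le> real m" unfolding m_def by (rule real_nat_ceiling_ge)
    then have "?r ^ 3 \<le> real m ^ 3" by (intro power_mono) auto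
    then have "n \<le> m ^ 3" unfolding r3 by (simp flip: of_nat_power)
    then have "real (dehn_function A R n) \<le> real (E * m ^ 7)"
      using dehn of_nat_le_iff by blast
    also have "\<dots> = real E * real m ^ 7" by simp
    also have "real m \<le> 2 * ?r"
    proof (cases "n = 0")
      case False
      then have "1 \<le> ?r" by (simp add: ge_one_powr_ge_zero)
      then show ?thesis unfolding m_def by linarith
    qed (simp add: m_def)
    then have "real m ^ 7 \<le> (2 * ?r) ^ 7" by (intro power_mono) auto
    then have "real E * real m ^ 7 \<le> real E * (2 * ?r) ^ 7" by (intro mult_left_mono) auto
    also have "\<dots> = 128 * real E * real n powr (7 / 3)"
      unfolding power_mult_distrib r7 by simp
    also have "\<dots> \<le> (128 * real E + 1) * real n powr (7 / 3)"
      by (intro mult_right_mono) auto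
    finally show ?thesis .
  qed
  \<comment> \<open>The summand 1 keeps the constant positive when \<open>E\<close> is 0.\<close>
  then show ?thesis
    by (intro exI[of _ "128 * real E + 1"]) (auto intro: add_nonneg_pos)
qed

end
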